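(* Let $R$ be a discrete valuation ring whose residue field has characteristic zero, with uniformizing parameter $t$. Let $(M,N)$ and $(M',N')$ be pairs of full-rank $r\times r$ matrices over $R$ which are pair equivalent, and let $\mu=inv(M)$ $(=inv(M'))$. Let $N^*$ and $N'^*$ be $\mu$-generic matrices such that $(D_\mu,N^* )$ is pair equivalent to $(M,N)$ and $(D_\mu,N'^* )$ is pair equivalent to $(M',N')$. Then the Littlewood–Richardson filling determined by $N^*$ equals the one determined by $N'^*$; that is, the arrays $\{k_{ij}\}$ defined from $N^*$ and from $N'^*$ by the rule in the context coincide.
   Context: For $0\ne a\in R$ write $a=ut^k$ with $u$ a unit and set $\|a\|=k$; for a square matrix $B$, $\|B\|=\|\det B\|$ (with $\|0\|=+\infty$). $inv(M)$ denotes the partition $(\mu_1\ge\dots\ge\mu_r\ge 0)$ of orders of the invariant factors of a full-rank $M$ (so $PMQ^{-1}=\mathrm{diag}(t^{\mu_1},\dots,t^{\mu_r})$ for some $P,Q\in GL_r(R)$), and $D_\mu=\mathrm{diag}(t^{\mu_1},\dots,t^{\mu_r})$. Pairs $(M,N),(M',N')$ are pair equivalent if $(M',N')=(PMQ^{-1},QNT^{-1})$ for some $P,Q,T\in GL_r(R)$. $Q\in GL_r(R)$ is $\mu$-admissible if $D_\mu QD_\mu^{-1}\in GL_r(R)$. For index sets $I=(i_1<\dots<i_k)$, $H=(h_1<\dots<h_k)$ in $\{1,\dots,r\}$, $I\subseteq H$ means $i_s\le h_s$ for all $s$; $W_{IJ}$ is the minor of $W$ with rows $I$, columns $J$; $|\mu_I|=\sum_s\mu_{i_s}$.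 An $r\times r$ matrix $N^*$ is $\mu$-generic if there exist a full-rank $N\in M_r(R)$ and invertible matrices $Q_U,Q_L,T_L,T_U$ over $R$ with $Q_U$ upper triangular $\mu$-admissible, $Q_L$ lower triangular $\mu$-admissible, $T_U$ upper triangular, $T_L$ a permutation matrix times (on the right) a lower triangular matrix, such that with $Q=Q_UQ_L$, $T^{-1}=T_LT_U$: $N^*=QNT^{-1}$; $Q=\widehat{Q_L}\widehat{Q_U}$ with $\widehat{Q_L},\widehat{Q_U}$ lower/upper triangular $\mu$-admissible over $R$; $Q_LNT_L$ is upper triangular; and for all index sets $I,J$ of equal length, $\|(QNT^{-1})_{IJ}\|=\min_{I\subseteq S}\|(Q_LNT^{-1})_{SJ}\|=\min_{H\subseteq I}\{\|(\widehat{Q_U}NT^{-1})_{HJ}\|+|\mu_H|-|\mu_I|\}=\min_{H\subseteq J}\|(QNT_L)_{IH}\|$. Filling determined by a $\mu$-generic $N^*$: for integers $a\le b$, let $\Omega(a,b)$ be the order of the minor of $N^*$ with rows $\{1,\dots,r\}\setminus\{a,\dots,b\}$ (indices outside $\{1,\dots,r\}$ ignored) and the right-most columns (the last $m$ columns, $m$ the number of rows kept; empty minor has order $0$). The array $\{k_{ij}:1\le i\le j\le r\}$ is defined by $k_{1j}+\dots+k_{ij}=\Omega(j-i,j-1)-\Omega(j-i+1,j)$ for all $1\le i\le j\le r$. *)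

theory Defs
  imports
    "Jordan_Normal_Form.Determinant"
    "Jordan_Normal_Form.DL_Submatrix"
    "HOL-Library.Extended_Nat"
    "HOL-Combinatorics.Permutations"
begin

section \<open>Discrete valuation rings\<close>

definition (in comm_ring_1) ring_ideal :: "'a set \<Rightarrow> bool" where
  "ring_ideal I \<longleftrightarrow>
     0 \<in> I \<and> (\<forall>x\<in>I. \<forall>y\<in>I. x + y \<in> I) \<and> (\<forall>c. \<forall>x\<in>I. c * x \<in> I)"

text \<open>A discrete valuation ring: a principal ideal domain that is local (the non-units
  form an ideal, which is then the unique maximal one) and is not a field.\<close>

class discrete_valuation_ring = idom +
  assumes principal_ideals: "ring_ideal I \<Longrightarrow> \<exists>a. I = range ((*) a)"
    and nonunits_ideal: "ring_ideal {x. \<not> x dvd 1}"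
    and not_a_field: "\<exists>x. x \<noteq> 0 \<and> \<not> x dvd 1"

text \<open>A generator of the maximal ideal.\<close>

definition uniformizer :: "'a::discrete_valuation_ring \<Rightarrow> bool" where
  "uniformizer t \<longleftrightarrow> {x. \<not> x dvd 1} = range ((*) t)"

text \<open>The residue field is \<open>R\<close> modulo the ideal of non-units, and \<open>n \<cdot> 1\<close> vanishes
  there iff \<open>of_nat n\<close> is a non-unit of \<open>R\<close>.\<close>

definition residue_field_char_0 :: "'a::discrete_valuation_ring itself \<Rightarrow> bool" where
  "residue_field_char_0 _ \<longleftrightarrow> (\<forall>n>0. of_nat n \<notin> {x :: 'a. \<not> x dvd 1})"

definition ord_at :: "'a::idom \<Rightarrow> 'a \<Rightarrow> enat" where
  "ord_at t a = (if a = 0 then \<infinity> else enat (THE k. \<exists>u. u dvd 1 \<and> a = u * t ^ k))"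

section \<open>Matrices and pairs of matrices\<close>

text \<open>Rank is taken over the field of fractions.\<close>

definition full_rank_mats :: "nat \<Rightarrow> 'a::idom mat set" where
  "full_rank_mats r = {A \<in> carrier_mat r r. det A \<noteq> 0}"

definition GL :: "nat \<Rightarrow> 'a::comm_ring_1 mat set" where
  "GL r = {A \<in> carrier_mat r r. invertible_mat A}"

definition is_inverse_mat :: "nat \<Rightarrow> 'a::comm_ring_1 mat \<Rightarrow> 'a mat \<Rightarrow> bool" where
  "is_inverse_mat r Q Q' \<longleftrightarrow>
     Q \<in> carrier_mat r r \<and> Q' \<in> carrier_mat r r \<and> inverts_mat Q Q' \<and> inverts_mat Q' Q"

text \<open>\<open>Q'\<close> and \<open>T'\<close> stand for the inverses of the invertible matrices \<open>Q\<close> and \<open>T\<close>.\<close>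

definition pair_equiv ::
  "nat \<Rightarrow> 'a::comm_ring_1 mat \<times> 'a mat \<Rightarrow> 'a mat \<times> 'a mat \<Rightarrow> bool" where
  "pair_equiv r = (\<lambda>(M, N) (M', N').
     \<exists>P Q Q' T T'. P \<in> GL r \<and> is_inverse_mat r Q Q' \<and> is_inverse_mat r T T' \<and>
       M' = P * M * Q' \<and> N' = Q * N * T')"

text \<open>Partitions are lists, numbered from 0: \<open>\<mu> ! i\<close> is the part \<open>\<mu>\<^sub>i\<^sub>+\<^sub>1\<close>, and \<open>r = length \<mu>\<close>.
  Rows, columns and index sets of matrices are likewise numbered from 0.\<close>

definition D_mat :: "'a::comm_ring_1 \<Rightarrow> nat list \<Rightarrow> 'a mat" where
  "D_mat t \<mu> = mat_diag (length \<mu>) (\<lambda>i. t ^ (\<mu> ! i))"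

definition is_inv :: "'a::comm_ring_1 \<Rightarrow> nat \<Rightarrow> 'a mat \<Rightarrow> nat list \<Rightarrow> bool" where
  "is_inv t r M \<mu> \<longleftrightarrow>
     length \<mu> = r \<and> sorted_wrt (\<ge>) \<mu> \<and>
     (\<exists>P Q Q'. P \<in> GL r \<and> is_inverse_mat r Q Q' \<and> P * M * Q' = D_mat t \<mu>)"

text \<open>\<open>D\<^sub>\<mu>\<close> is in general invertible only over the field of fractions;
  \<open>W * D\<^sub>\<mu> = D\<^sub>\<mu> * Q\<close> says \<open>W = D\<^sub>\<mu> Q D\<^sub>\<mu>\<^sup>-\<^sup>1\<close>.\<close>

definition admissible :: "'a::comm_ring_1 \<Rightarrow> nat list \<Rightarrow> 'a mat \<Rightarrow> bool" where
  "admissible t \<mu> Q \<longleftrightarrow>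
     Q \<in> GL (length \<mu>) \<and> (\<exists>W \<in> GL (length \<mu>). W * D_mat t \<mu> = D_mat t \<mu> * Q)"

definition lower_triangular :: "'a::zero mat \<Rightarrow> bool" where
  "lower_triangular A \<longleftrightarrow> upper_triangular (transpose_mat A)"

definition permutation_mat :: "nat \<Rightarrow> (nat \<Rightarrow> nat) \<Rightarrow> 'a::zero_neq_one mat" where
  "permutation_mat r p = mat r r (\<lambda>(i, j). if i = p j then 1 else 0)"

section \<open>Generic matrices\<close>

text \<open>\<open>pick I s\<close> is the element number \<open>s\<close> (from 0) of \<open>I\<close> in increasing order.\<close>

definition index_le :: "nat set \<Rightarrow> nat set \<Rightarrow> bool" where
  "index_le I H \<longleftrightarrow> card I = card H \<and> (\<forall>s < card I. pick I s \<le> pick H s)"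

definition ord_minor :: "'a::idom \<Rightarrow> 'a mat \<Rightarrow> nat set \<Rightarrow> nat set \<Rightarrow> enat" where
  "ord_minor t W I J = ord_at t (det (submatrix W I J))"

definition part_sum :: "nat list \<Rightarrow> nat set \<Rightarrow> nat" where
  "part_sum \<mu> I = (\<Sum>i\<in>I. \<mu> ! i)"

text \<open>The matrix called \<open>T\<^sup>-\<^sup>1\<close> in the source is \<open>TL * TU\<close>. For a partition \<open>\<mu>\<close>, the
  subtraction in \<open>enat\<close> below is never truncated: \<open>index_le H I\<close> gives
  \<open>part_sum \<mu> H \<ge> part_sum \<mu> I\<close>.\<close>

definition mu_generic :: "'a::idom \<Rightarrow> nat list \<Rightarrow> 'a mat \<Rightarrow> bool" where
  "mu_generic t \<mu> Ns \<longleftrightarrow> (let r = length \<mu> in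
     \<exists>N QU QL TL TU QLh QUh.
       N \<in> full_rank_mats r \<and>
       upper_triangular QU \<and> admissible t \<mu> QU \<and>
       lower_triangular QL \<and> admissible t \<mu> QL \<and>
       TU \<in> GL r \<and> upper_triangular TU \<and>
       TL \<in> GL r \<and>
       (\<exists>p L. p permutes {..<r} \<and> L \<in> carrier_mat r r \<and> lower_triangular L \<and>
          TL = permutation_mat r p * L) \<and>
       Ns = (QU * QL) * N * (TL * TU) \<and>
       QU * QL = QLh * QUh \<and>
       lower_triangular QLh \<and> admissible t \<mu> QLh \<and>
       upper_triangular QUh \<and> admissible t \<mu> QUh \<and>
       upper_triangular (QL * N * TL) \<and>
       (\<forall>I J. I \<subseteq> {..<r} \<and> J \<subseteq> {..<r} \<and> card I = card J \<longrightarrow>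
          ord_minor t ((QU * QL) * N * (TL * TU)) I J
            = (MIN S \<in> {S. S \<subseteq> {..<r} \<and> index_le I S}.
                 ord_minor t (QL * N * (TL * TU)) S J) \<and>
          ord_minor t ((QU * QL) * N * (TL * TU)) I J
            = (MIN H \<in> {H. H \<subseteq> {..<r} \<and> index_le H I}.
                 ord_minor t (QUh * N * (TL * TU)) H J
                   + enat (part_sum \<mu> H) - enat (part_sum \<mu> I)) \<and>
          ord_minor t ((QU * QL) * N * (TL * TU)) I J
            = (MIN H \<in> {H. H \<subseteq> {..<r} \<and> index_le H J}.
                 ord_minor t ((QU * QL) * N * TL) I H)))"

section \<open>The filling determined by a generic matrix\<close>

text \<open>\<open>a\<close>, \<open>b\<close> are 1-based row numbers, hence the shift. For a generic matrix the minor is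
  nonzero (minimise over \<open>H\<close> in the last condition above, where \<open>J\<close> consists of the
  right-most columns, so that all \<open>H\<close> occur), so its order is finite.\<close>

definition Omega :: "'a::idom \<Rightarrow> nat \<Rightarrow> 'a mat \<Rightarrow> int \<Rightarrow> int \<Rightarrow> int" where
  "Omega t r Ns a b =
     (let I = {i. i < r \<and> int (i + 1) \<notin> {a..b}}
      in int (the_enat (ord_minor t Ns I {r - card I ..< r})))"

definition filling_of ::
  "'a::idom \<Rightarrow> nat \<Rightarrow> 'a mat \<Rightarrow> (nat \<Rightarrow> nat \<Rightarrow> int) \<Rightarrow> bool" where
  "filling_of t r Ns k \<longleftrightarrow>
     (\<forall>i j. 1 \<le> i \<and> i \<le> j \<and> j \<le> r \<longrightarrow>
        (\<Sum>s = 1..i. k s j) =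
          Omega t r Ns (int j - int i) (int j - 1) - Omega t r Ns (int j - int i + 1) (int j))"

end

(*
Let \<omega>(I) be the order of the minor of a generic matrix A with rows I and right-most columns. The
genericity conditions say that \<omega>(I) is least among the minors with rows I, that \<omega> increases with I,
and that \<omega>(I) + |\<mu>_I| decreases with I. For a fixed gap length m let I_p consist of the first p
rows and the last r - m - p rows, and let g(p) = \<omega>(I_p) + \<mu>_{m+p+1} + ... + \<mu>_r.

For every c, the least order of an (r - m)-minor of diag(t^min(\<mu>_i, c)) A is invariant under pair
equivalence, because admissible matrices stay integral under conjugation by this diagonal matrix.
Genericity identifies it with the minimum over p of g(p) + c p, the Legendre transform of g. The
three-term Pluecker relations make g convex and decreasing, so g is recovered from its transform;
hence all \<omega>(I_p), and with them the filling, are invariants of the pair.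
*)

theory Submission
  imports Defs
begin

section \<open>Orders in a discrete valuation ring\<close>

text \<open>The order of one chosen minor is not visibly invariant: left multiplication by
  \<open>Q\<close> mixes rows, so only minima over all row sets of a given size survive. The number
  c tells the values of p apart. After truncation every row with part at least c costs c and every
  other row costs its part. Rows of the first group may slide up and rows of the second may slide
  down without raising the total, so a cheapest row set can be taken as p leading rows at price c
  and a tail at full price; this is the origin of g(p) + c p.

  Convexity of g encodes the Littlewood-Richardson inequalities. With S_i(j) = k_1j + ... + k_ij it
  is the chain \<mu>_(j+1) + S_m(j+1) <= \<mu>_j + S_(m-1)(j) <= \<mu>_j + S_m(j): column
  strictness, then k_mj >= 0. Monotonicity of g makes the numbers g(p) - g(p+1) natural, so that an
  exponent c supporting g at p exists. One such c per p gives one inequality between the two generic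
  matrices; exchanging them gives the other.\<close>

lemma uniformizer_dvd_iff: "uniformizer t \<Longrightarrow> t dvd x \<longleftrightarrow> \<not> x dvd 1"
  unfolding uniformizer_def dvd_def[of t] by blast

lemma uniformizer_nonzero:
  assumes "uniformizer (t :: 'a::discrete_valuation_ring)"
  shows "t \<noteq> 0"
proof
  assume "t = 0"
  moreover obtain x :: 'a where "x \<noteq> 0" "\<not> x dvd 1"
    using not_a_field by blast
  ultimately show False
    using uniformizer_dvd_iff[OF assms, of x] by simp
qed

text \<open>The elements divisible by all powers of \<open>t\<close> form an ideal, so they are the
  multiples of a single b. The quotient of b by \<open>t\<close> lies in the ideal again, hence b =
  t b d for some d, and 1 - t d is nonzero because \<open>t\<close> is not a unit.\<close>

lemma infinitely_divisible_imp_zero: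
  fixes t :: "'a::discrete_valuation_ring"
  assumes t: "uniformizer t" and a: "\<And>k. t ^ k dvd a"
  shows "a = 0"
proof -
  let ?I = "{x. \<forall>k. t ^ k dvd x}"
  have "ring_ideal ?I"
    unfolding ring_ideal_def by (auto intro: dvd_add dvd_mult)
  then obtain b where b: "?I = range ((*) b)"
    using principal_ideals by blast
  have "b \<in> ?I"
    unfolding b using rangeI[of "(*) b" 1] by simp
  then have tb: "t ^ k dvd b" for k
    by simp
  then obtain c where c: "b = t * c"
    using tb[of 1] by (auto simp: dvd_def)
  have "t ^ k dvd c" for k
    using tb[of "Suc k"] uniformizer_nonzero[OF t] by (simp add: c)
  then obtain d where d: "c = b * d"
    using b by blast
  have "b * (1 - t * d) = 0"
    using c d by (simp add: algebra_simps)
  moreover have "1 - t * d \<noteq> 0"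
    using uniformizer_dvd_iff[OF t, of 1] by (metis dvd_refl dvd_triv_left eq_iff_diff_eq_0)
  ultimately have "b = 0"
    by simp
  moreover obtain e where "a = b * e"
    using b a by blast
  ultimately show ?thesis
    by simp
qed

lemma unit_times_uniformizer_power:
  fixes t :: "'a::discrete_valuation_ring"
  assumes t: "uniformizer t" and "a \<noteq> 0"
  obtains u k where "u dvd 1" "a = u * t ^ k"
proof -
  obtain m where "\<not> t ^ m dvd a"
    using infinitely_divisible_imp_zero[OF t] assms(2) by blast
  then obtain k where k: "t ^ k dvd a" "\<not> t ^ Suc k dvd a"
    using ex_least_nat_less[of "\<lambda>m. \<not> t ^ m dvd a" m] by auto
  then obtain u where u: "a = u * t ^ k"
    by (metis dvdE mult.commute)
  with k(2) have "\<not> t dvd u"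
    using mult_dvd_mono[of t u "t ^ k" "t ^ k"] by (auto simp: mult.commute)
  with u that show thesis
    using uniformizer_dvd_iff[OF t] by blast
qed

lemma power_dvd_unit_times_power_iff:
  fixes t :: "'a::discrete_valuation_ring"
  assumes t: "uniformizer t" and u: "u dvd 1"
  shows "t ^ n dvd u * t ^ k \<longleftrightarrow> n \<le> k"
proof
  show "n \<le> k \<Longrightarrow> t ^ n dvd u * t ^ k"
    by (simp add: le_imp_power_dvd)
next
  assume dvd: "t ^ n dvd u * t ^ k"
  show "n \<le> k"
  proof (rule ccontr)
    assume "\<not> n \<le> k"
    then have "t ^ Suc k dvd u * t ^ k"
      using dvd by (meson dvd_trans le_imp_power_dvd not_less_eq_eq)
    then have "t dvd u"
      using uniformizer_nonzero[OF t] by (simp add: mult.commute)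
    with u show False
      using uniformizer_dvd_iff[OF t] by blast
  qed
qed

lemma ord_at_unit_times_power:
  fixes t :: "'a::discrete_valuation_ring"
  assumes t: "uniformizer t" and u: "u dvd 1"
  shows "ord_at t (u * t ^ k) = enat k"
proof -
  have "u * t ^ k \<noteq> 0"
    using uniformizer_nonzero[OF t] u by auto
  moreover have "(THE k'. \<exists>u'. u' dvd 1 \<and> u * t ^ k = u' * t ^ k') = k"
  proof (rule the_equality)
    fix k' assume "\<exists>u'. u' dvd 1 \<and> u * t ^ k = u' * t ^ k'"
    then obtain u' where "u' dvd 1" "u * t ^ k = u' * t ^ k'"
      by blast
    then show "k' = k"
      using power_dvd_unit_times_power_iff[OF t u, of k' k]
        power_dvd_unit_times_power_iff[OF t \<open>u' dvd 1\<close>, of k k']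
      by (metis dvd_triv_right le_antisym)
  qed (use u in blast)
  ultimately show ?thesis
    by (simp add: ord_at_def)
qed

text \<open>Turns inequalities between orders into divisibility by powers of \<open>t\<close>,
  uniformly including the zero element of infinite order.\<close>

lemma le_ord_at_iff:
  fixes t :: "'a::discrete_valuation_ring"
  assumes t: "uniformizer t"
  shows "enat n \<le> ord_at t a \<longleftrightarrow> t ^ n dvd a"
proof (cases "a = 0")
  case False
  then obtain u k where u: "u dvd 1" "a = u * t ^ k"
    using unit_times_uniformizer_power[OF t] by blast
  then show ?thesis
    using ord_at_unit_times_power[OF t] power_dvd_unit_times_power_iff[OF t] by simp
qed (simp add: ord_at_def)

lemma ord_at_mono_dvd:
  fixes t :: "'a::discrete_valuation_ring"
  assumes t: "uniformizer t" and "a dvd b"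
  shows "ord_at t a \<le> ord_at t b"
proof (cases "ord_at t a")
  case (enat n)
  then have "t ^ n dvd a"
    using le_ord_at_iff[OF t, of n a] by simp
  then show ?thesis
    unfolding enat using le_ord_at_iff[OF t] assms(2) dvd_trans by blast
next
  case infinity
  then have "a = 0"
    by (auto simp: ord_at_def split: if_splits)
  then show ?thesis
    using assms(2) by simp
qed

lemma ord_at_mult:
  fixes t :: "'a::discrete_valuation_ring"
  assumes t: "uniformizer t"
  shows "ord_at t (a * b) = ord_at t a + ord_at t b"
proof (cases "a = 0 \<or> b = 0")
  case False
  then obtain u k v l where u: "u dvd 1" "a = u * t ^ k" and v: "v dvd 1" "b = v * t ^ l"
    using unit_times_uniformizer_power[OF t] by metis
  then have "a * b = (u * v) * t ^ (k + l)"
    by (simp add: power_add algebra_simps)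
  moreover have "u * v dvd 1"
    using u(1) v(1) mult_dvd_mono by fastforce
  ultimately have "ord_at t (a * b) = enat (k + l)"
    using ord_at_unit_times_power[OF t] by metis
  then show ?thesis
    using u v ord_at_unit_times_power[OF t] by simp
qed (auto simp: ord_at_def)

lemma ord_at_add_ge:
  fixes t :: "'a::discrete_valuation_ring"
  assumes t: "uniformizer t"
  shows "min (ord_at t a) (ord_at t b) \<le> ord_at t (a + b)"
proof (cases "min (ord_at t a) (ord_at t b)")
  case (enat n)
  then have "enat n \<le> ord_at t a" "enat n \<le> ord_at t b"
    by (metis min.cobounded1, metis min.cobounded2)
  then show ?thesis
    unfolding enat by (simp add: le_ord_at_iff[OF t] dvd_add)
next
  case infinity
  then have "a = 0" "b = 0"
    by (auto simp: ord_at_def min_def split: if_splits)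
  then show ?thesis
    by (simp add: ord_at_def)
qed

lemma ord_at_finite: "a \<noteq> 0 \<Longrightarrow> ord_at t a \<noteq> \<infinity>"
  by (simp add: ord_at_def)

section \<open>The order on index sets\<close>

lemma index_le_refl: "index_le I I"
  by (simp add: index_le_def)

lemma index_le_trans: "index_le I H \<Longrightarrow> index_le H S \<Longrightarrow> index_le I S"
  unfolding index_le_def by (metis le_trans)

text \<open>If \<open>pick H s\<close> came before \<open>pick I s\<close>, the initial segment
  ending at \<open>pick H s\<close> would contain s + 1 elements of \<open>H\<close> but at most s
  of \<open>I\<close>. Counting in initial segments avoids computing \<open>pick\<close> on
  unions.\<close>

lemma index_leI_counting:
  assumes "finite I" "finite H" and card: "card I = card H"
    and le: "\<And>m. card (H \<inter> {..<m}) \<le> card (I \<inter> {..<m})"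
  shows "index_le I H"
  unfolding index_le_def
proof (intro conjI allI impI)
  fix s assume s: "s < card I"
  show "pick I s \<le> pick H s"
  proof (rule ccontr)
    assume less: "\<not> pick I s \<le> pick H s"
    let ?h = "pick H s"
    have "H \<inter> {..<Suc ?h} = insert ?h {a\<in>H. a < ?h}"
      using pick_in_set_le[of s H] s card by auto
    then have "card (H \<inter> {..<Suc ?h}) = Suc s"
      using card_pick_le[of s H] s card assms(2) by simp
    moreover have "card (I \<inter> {..<Suc ?h}) \<le> card {a\<in>I. a < pick I s}"
      using less assms(1) by (intro card_mono) auto
    moreover have "card {a\<in>I. a < pick I s} = s"
      using card_pick_le[of s I] s by simp
    ultimately show False
      using le[of "Suc ?h"] by simp
  qed
qed (rule card)

lemma index_le_insert_mono:
  assumes "finite K" "a \<notin> K" "b \<notin> K" "a \<le> b"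
  shows "index_le (insert a K) (insert b K)"
proof (rule index_leI_counting)
  fix m
  show "card (insert b K \<inter> {..<m}) \<le> card (insert a K \<inter> {..<m})"
    using assms by (cases "a < m"; cases "b < m") (auto simp: Int_insert_left)
qed (use assms in auto)

lemma index_le_rightmost:
  assumes "J \<subseteq> {..<r}"
  shows "index_le J {r - card J..<r}"
proof (rule index_leI_counting)
  have fin: "finite J"
    using assms finite_subset by blast
  have cJ: "card J \<le> r"
    using card_mono[OF _ assms] by simp
  then show "card J = card {r - card J..<r}"
    by simp
  fix m
  have "{r - card J..<r} \<inter> {..<m} = {r - card J..<min m r}"
    by auto
  moreover have "card J \<le> card (J \<inter> {..<m}) + (r - m)"
  proof -
    have "card J = card (J \<inter> {..<m}) + card (J - {..<m})"
      using card_Int_Diff[OF fin] by blast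
    moreover have "card (J - {..<m}) \<le> card {m..<r}"
      using assms by (intro card_mono) auto
    ultimately show ?thesis
      by simp
  qed
  ultimately show "card ({r - card J..<r} \<inter> {..<m}) \<le> card (J \<inter> {..<m})"
    using cJ by simp
qed (use assms finite_subset in auto)

lemma bij_betw_pick:
  assumes "finite I"
  shows "bij_betw (pick I) {..<card I} I"
proof -
  have "inj_on (pick I) {..<card I}"
    by (rule linorder_inj_onI) (use pick_mono_le in \<open>fastforce+\<close>)
  moreover have "pick I ` {..<card I} \<subseteq> I"
    using pick_in_set_le by blast
  ultimately show ?thesis
    using assms by (simp add: bij_betw_def card_image card_subset_eq)
qed

text \<open>Guarantees that the subtraction of \<open>enat\<close> values in the second genericity
  formula is not truncated.\<close>

lemma part_sum_antimono:
  assumes \<mu>: "sorted_wrt (\<ge>) \<mu>" and "I \<subseteq> {..<length \<mu>}" "H \<subseteq> {..<length \<mu>}" "index_le H I"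
  shows "part_sum \<mu> I \<le> part_sum \<mu> H"
proof -
  have fin: "finite I" "finite H"
    using assms finite_subset by blast+
  have card: "card H = card I" and le: "\<And>s. s < card I \<Longrightarrow> pick H s \<le> pick I s"
    using \<open>index_le H I\<close> by (auto simp: index_le_def)
  have eq: "part_sum \<mu> X = (\<Sum>s<card X. \<mu> ! pick X s)" if "finite X" for X
    unfolding part_sum_def using sum.reindex_bij_betw[OF bij_betw_pick[OF that], of "(!) \<mu>"] by simp
  have "\<mu> ! pick I s \<le> \<mu> ! pick H s" if "s < card I" for s
  proof -
    have "pick I s < length \<mu>"
      using pick_in_set_le[OF that] assms(2) by auto
    then show ?thesis
      using sorted_wrt_nth_less[OF \<mu>, of "pick H s" "pick I s"] le[OF that]
      by (cases "pick H s = pick I s") auto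
  qed
  then show ?thesis
    unfolding eq[OF fin(1)] eq[OF fin(2)] card by (intro sum_mono) simp
qed

section \<open>Minors indexed by functions\<close>

text \<open>Rows and columns are listed by arbitrary functions, neither increasing nor injective.
  Multilinear expansion and the Pluecker relation produce such lists; reordering costs only a sign
  and repetition only a zero, neither of which harms divisibility.\<close>

definition minor_at :: "'a::comm_ring_1 mat \<Rightarrow> nat \<Rightarrow> (nat \<Rightarrow> nat) \<Rightarrow> (nat \<Rightarrow> nat) \<Rightarrow> 'a" where
  "minor_at A k f g = det (mat k k (\<lambda>(i, j). A $$ (f i, g j)))"

lemma minor_at_cong:
  assumes "\<And>i. i < k \<Longrightarrow> f i = f' i" "\<And>j. j < k \<Longrightarrow> g j = g' j"
  shows "minor_at A k f g = minor_at A k f' g'"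
  unfolding minor_at_def by (rule arg_cong[of _ _ det]) (use assms in auto)

lemma minor_at_transpose:
  assumes A: "A \<in> carrier_mat n m" and "\<And>i. i < k \<Longrightarrow> f i < n" "\<And>j. j < k \<Longrightarrow> g j < m"
  shows "minor_at (transpose_mat A) k g f = minor_at A k f g"
proof -
  have "mat k k (\<lambda>(i, j). transpose_mat A $$ (g i, f j))
      = transpose_mat (mat k k (\<lambda>(i, j). A $$ (f i, g j)))"
    by (rule eq_matI) (use assms in auto)
  then show ?thesis
    unfolding minor_at_def by (simp add: det_transpose[of _ k])
qed

lemma minor_at_permute_rows:
  assumes "p permutes {0..<k}"
  shows "minor_at A k (f \<circ> p) g = signof p * minor_at A k f g"
proof -
  let ?B = "mat k k (\<lambda>(i, j). A $$ (f i, g j))"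
  have "p i < k" if "i < k" for i
    using permutes_in_image[OF assms, of i] that by simp
  then have "mat k k (\<lambda>(i, j). A $$ ((f \<circ> p) i, g j)) = mat k k (\<lambda>(i, j). ?B $$ (p i, j))"
    by (intro eq_matI) auto
  then show ?thesis
    unfolding minor_at_def using det_permute_rows[of ?B k p] assms by simp
qed

text \<open>The two listings differ by a permutation, hence the minors by a sign. Divisibility
  absorbs the sign; used in both directions it gives equal orders.\<close>

lemma minor_at_dvd_same_rows:
  assumes "inj_on f {..<k}" "inj_on f' {..<k}" "f ` {..<k} = f' ` {..<k}"
  shows "minor_at A k f g dvd minor_at A k f' g"
proof -
  define p where "p i = (if i < k then inv_into {..<k} f (f' i) else i)" for i
  have fp: "p i < k" "f (p i) = f' i" if "i < k" for i
  proof -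
    have "f' i \<in> f ` {..<k}"
      using that assms(3) by blast
    then show "p i < k" "f (p i) = f' i"
      using that inv_into_into[of "f' i" f "{..<k}"] f_inv_into_f[of "f' i" f "{..<k}"]
      by (auto simp: p_def)
  qed
  have "inj_on p {0..<k}"
    using fp assms(2) by (metis atLeastLessThan_iff inj_on_def lessThan_iff)
  then have "p permutes {0..<k}"
    using fp by (intro inj_on_nat_permutes) (auto simp: p_def)
  then have "minor_at A k (f \<circ> p) g = signof p * minor_at A k f g"
    by (rule minor_at_permute_rows)
  moreover have "minor_at A k (f \<circ> p) g = minor_at A k f' g"
    by (rule minor_at_cong) (use fp in auto)
  ultimately show ?thesis
    by simp
qed

lemma minor_at_repeated_row:
  assumes "i < k" "j < k" "i \<noteq> j" "f i = f j"
  shows "minor_at A k f g = 0"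
proof -
  let ?B = "mat k k (\<lambda>(i, j). A $$ (f i, g j))"
  have "row ?B i = row ?B j"
    by (rule eq_vecI) (simp_all add: assms)
  then show ?thesis
    unfolding minor_at_def using det_identical_rows[of ?B k i j] assms by simp
qed

text \<open>A divisibility form of Cauchy-Binet: each row of the product is a combination of rows of
  \<open>A\<close>, so multilinearity writes the minor as a sum of entries of \<open>W\<close> times
  minors of \<open>A\<close>. The row lists h that occur may repeat rows, which is why the
  hypothesis ranges over all of them.\<close>

lemma dvd_minor_at_mult_left:
  fixes W A :: "'a::comm_ring_1 mat"
  assumes W: "W \<in> carrier_mat n' n" and A: "A \<in> carrier_mat n m"
    and f: "\<And>i. i < k \<Longrightarrow> f i < n'" and g: "\<And>j. j < k \<Longrightarrow> g j < m"
    and dvd: "\<And>h. (\<And>i. i < k \<Longrightarrow> h i < n) \<Longrightarrow> d dvd minor_at A k h g"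
  shows "d dvd minor_at (W * A) k f g"
proof -
  let ?v = "\<lambda>l. vec k (\<lambda>j. A $$ (l, g j))"
  let ?H = "{h. (\<forall>i\<in>{0..<k}. h i \<in> {0..<n}) \<and> (\<forall>i. i \<notin> {0..<k} \<longrightarrow> h i = i)}"
  have "mat k k (\<lambda>(i, j). (W * A) $$ (f i, g j))
      = mat\<^sub>r k k (\<lambda>i. finsum_vec TYPE('a) k (\<lambda>l. W $$ (f i, l) \<cdot>\<^sub>v ?v l) {0..<n})"
  proof (rule eq_matI; clarsimp)
    fix i j assume ij: "i < k" "j < k"
    have "(\<lambda>l. W $$ (f i, l) \<cdot>\<^sub>v ?v l) \<in> {0..<n} \<rightarrow> carrier_vec k"
      by auto
    then have "finsum_vec TYPE('a) k (\<lambda>l. W $$ (f i, l) \<cdot>\<^sub>v ?v l) {0..<n} $ j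
        = (\<Sum>l = 0..<n. W $$ (f i, l) * A $$ (l, g j))"
      using ij by (subst index_finsum_vec) (auto intro!: sum.cong)
    moreover have "(W * A) $$ (f i, g j) = (\<Sum>l = 0..<n. W $$ (f i, l) * A $$ (l, g j))"
      using W A f[OF ij(1)] g[OF ij(2)] by (auto simp: scalar_prod_def intro!: sum.cong)
    ultimately show "(W * A) $$ (f i, g j)
        = finsum_vec TYPE('a) k (\<lambda>l. W $$ (f i, l) \<cdot>\<^sub>v ?v l) {0..<n} $ j"
      by simp
  qed
  then have "minor_at (W * A) k f g
      = (\<Sum>h\<in>?H. det (mat\<^sub>r k k (\<lambda>i. W $$ (f i, h i) \<cdot>\<^sub>v ?v (h i))))"
    unfolding minor_at_def by (simp only:) (rule det_linear_rows_sum, auto)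
  moreover have "d dvd det (mat\<^sub>r k k (\<lambda>i. W $$ (f i, h i) \<cdot>\<^sub>v ?v (h i)))" if "h \<in> ?H" for h
  proof -
    have "det (mat\<^sub>r k k (\<lambda>i. W $$ (f i, h i) \<cdot>\<^sub>v ?v (h i)))
        = (\<Prod>i = 0..<k. W $$ (f i, h i)) * det (mat\<^sub>r k k (\<lambda>i. ?v (h i)))"
      by (rule det_rows_mul) auto
    also have "mat\<^sub>r k k (\<lambda>i. ?v (h i)) = mat k k (\<lambda>(i, j). A $$ (h i, g j))"
      by (rule eq_matI) auto
    finally show ?thesis
      using dvd[of h] that unfolding minor_at_def by auto
  qed
  ultimately show ?thesis
    by (simp only:) (rule dvd_sum)
qed

lemma dvd_minor_at_mult_right:
  fixes T A :: "'a::comm_ring_1 mat"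
  assumes A: "A \<in> carrier_mat n m" and T: "T \<in> carrier_mat m m'"
    and f: "\<And>i. i < k \<Longrightarrow> f i < n" and g: "\<And>j. j < k \<Longrightarrow> g j < m'"
    and dvd: "\<And>h. (\<And>j. j < k \<Longrightarrow> h j < m) \<Longrightarrow> d dvd minor_at A k f h"
  shows "d dvd minor_at (A * T) k f g"
proof -
  have "d dvd minor_at (transpose_mat T * transpose_mat A) k g f"
  proof (rule dvd_minor_at_mult_left)
    show "transpose_mat T \<in> carrier_mat m' m" "transpose_mat A \<in> carrier_mat m n"
      using A T by auto
    show "d dvd minor_at (transpose_mat A) k h f" if "\<And>j. j < k \<Longrightarrow> h j < m" for h
      using dvd[OF that] minor_at_transpose[OF A f that] by simp
  qed (use f g in auto)
  also have "transpose_mat T * transpose_mat A = transpose_mat (A * T)"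
    using transpose_mult[OF A T] by simp
  also have "minor_at (transpose_mat (A * T)) k g f = minor_at (A * T) k f g"
    by (rule minor_at_transpose[of _ n m']) (use A T f g in auto)
  finally show ?thesis .
qed

text \<open>Expand along its last column the square matrix with rows \<open>K, x, y, z\<close> of \<open>A\<close> and one more
  column listing the minors with rows \<open>K\<close> and that row: the extra column depends linearly on the
  others, so the determinant vanishes.\<close>

lemma three_term_pluecker:
  fixes A :: "'a::idom mat"
  shows "minor_at A (Suc q) (h(q := x)) g * minor_at A (q + 2) (h(q := y, Suc q := z)) g
    - minor_at A (Suc q) (h(q := y)) g * minor_at A (q + 2) (h(q := x, Suc q := z)) g
    + minor_at A (Suc q) (h(q := z)) g * minor_at A (q + 2) (h(q := x, Suc q := y)) g = 0"
proof -
  define \<rho> where "\<rho> = h(q := x, Suc q := y, q + 2 := z)"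
  define l where "l i = minor_at A (Suc q) (h(q := i)) g" for i
  define C where "C i = mat (Suc q) (Suc q) (\<lambda>(i', j). A $$ ((h(q := i)) i', g j))" for i
  define E where "E = mat (q + 3) (q + 3)
    (\<lambda>(i, j). if j < q + 2 then A $$ (\<rho> i, g j) else l (\<rho> i))"
  define v where "v = vec (q + 3)
    (\<lambda>j. if j < Suc q then cofactor (C x) q j else if j = Suc q then 0 else - 1)"
  \<comment> \<open>Only the last row of \<open>C i\<close> depends on i, so the cofactors along
    that row do not. The coefficients of this combination, a zero and the entry -1 make up
    \<open>v\<close>, a kernel vector of \<open>E\<close>.\<close>
  have l: "l i = (\<Sum>j<Suc q. A $$ (i, g j) * cofactor (C x) q j)" for i
  proof -
    have "l i = (\<Sum>j<Suc q. C i $$ (q, j) * cofactor (C i) q j)"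
      unfolding l_def minor_at_def C_def[symmetric]
      by (rule laplace_expansion_row) (auto simp: C_def)
    moreover have "cofactor (C i) q j = cofactor (C x) q j" if "j < Suc q" for j
    proof -
      have "mat_delete (C i) q j = mat_delete (C x) q j"
        by (rule eq_matI) (auto simp: mat_delete_def C_def)
      then show ?thesis
        by (simp add: cofactor_def)
    qed
    ultimately show ?thesis
      by (simp add: C_def)
  qed
  have E: "E \<in> carrier_mat (q + 3) (q + 3)"
    by (simp add: E_def)
  have "E *\<^sub>v v = 0\<^sub>v (q + 3)"
  proof (rule eq_vecI)
    fix i assume "i < dim_vec (0\<^sub>v (q + 3) :: 'a vec)"
    then have i: "i < q + 3"
      by simp
    then have "(E *\<^sub>v v) $ i = (\<Sum>j<q + 3. E $$ (i, j) * v $ j)"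
      by (auto simp: E_def v_def scalar_prod_def atLeast0LessThan intro!: sum.cong)
    also have "\<dots> = (\<Sum>j<Suc q. E $$ (i, j) * v $ j)
        + E $$ (i, Suc q) * v $ Suc q + E $$ (i, q + 2) * v $ (q + 2)"
      by (simp add: numeral_3_eq_3)
    also have "(\<Sum>j<Suc q. E $$ (i, j) * v $ j)
        = (\<Sum>j<Suc q. A $$ (\<rho> i, g j) * cofactor (C x) q j)"
      by (rule sum.cong) (use i in \<open>auto simp: E_def v_def\<close>)
    also have "\<dots> = l (\<rho> i)"
      by (simp only: l)
    finally show "(E *\<^sub>v v) $ i = 0\<^sub>v (q + 3) $ i"
      using i by (simp add: E_def v_def)
  qed (simp add: E_def)
  moreover have "v \<in> carrier_vec (q + 3)"
    by (simp add: v_def)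
  moreover have "v \<noteq> 0\<^sub>v (q + 3)"
  proof
    assume "v = 0\<^sub>v (q + 3)"
    then have "v $ (q + 2) = 0"
      by simp
    then show False
      by (simp add: v_def)
  qed
  ultimately have "det E = 0"
    using det_0_iff_vec_prod_zero[OF E] by blast
  have mdel: "det (mat_delete E i (q + 2)) = minor_at A (q + 2) (\<lambda>s. \<rho> (if s < i then s else Suc s)) g"
    if "i < q + 3" for i
    unfolding minor_at_def
    by (rule arg_cong[of _ _ det], rule eq_matI) (use that in \<open>auto simp: mat_delete_def E_def\<close>)
  \<comment> \<open>In the expansion of \<open>det E\<close> along its last column the rows of the
    common part drop out, because there l is a minor with a repeated row; the rows of x, y and z
    remain, with alternating signs.\<close>
  have "l (\<rho> i) = 0" if "i < q" for i
    unfolding l_def by (rule minor_at_repeated_row[of i _ q]) (use that in \<open>auto simp: \<rho>_def\<close>)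
  then have "(\<Sum>i<q. E $$ (i, q + 2) * cofactor E i (q + 2)) = 0"
    by (intro sum.neutral) (auto simp: E_def)
  moreover have "det E = (\<Sum>i<q + 3. E $$ (i, q + 2) * cofactor E i (q + 2))"
    by (rule laplace_expansion_column[OF E]) simp
  ultimately have "0 = E $$ (q, q + 2) * cofactor E q (q + 2)
      + E $$ (Suc q, q + 2) * cofactor E (Suc q) (q + 2)
      + E $$ (q + 2, q + 2) * cofactor E (q + 2) (q + 2)"
    using \<open>det E = 0\<close> by (simp add: numeral_3_eq_3)
  also have "E $$ (q, q + 2) = l x"
    by (simp add: E_def \<rho>_def)
  also have "E $$ (Suc q, q + 2) = l y"
    by (simp add: E_def \<rho>_def)
  also have "E $$ (q + 2, q + 2) = l z"
    by (simp add: E_def \<rho>_def)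
  also have "cofactor E q (q + 2) = minor_at A (q + 2) (h(q := y, Suc q := z)) g"
  proof -
    have "det (mat_delete E q (q + 2)) = minor_at A (q + 2) (h(q := y, Suc q := z)) g"
      by (subst mdel, simp, rule minor_at_cong) (auto simp: \<rho>_def)
    then show ?thesis
      by (simp add: cofactor_def)
  qed
  also have "cofactor E (Suc q) (q + 2) = - minor_at A (q + 2) (h(q := x, Suc q := z)) g"
  proof -
    have "det (mat_delete E (Suc q) (q + 2)) = minor_at A (q + 2) (h(q := x, Suc q := z)) g"
      by (subst mdel, simp, rule minor_at_cong) (auto simp: \<rho>_def)
    then show ?thesis
      by (simp add: cofactor_def)
  qed
  also have "cofactor E (q + 2) (q + 2) = minor_at A (q + 2) (h(q := x, Suc q := y)) g"
  proof -
    have "det (mat_delete E (q + 2) (q + 2)) = minor_at A (q + 2) (h(q := x, Suc q := y)) g"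
      by (subst mdel, simp, rule minor_at_cong) (auto simp: \<rho>_def)
    then show ?thesis
      by (simp add: cofactor_def)
  qed
  finally show ?thesis
    by (simp only: l_def mult_minus_right diff_conv_add_uminus)
qed

text \<open>Any enumerations of the two index sets may replace the increasing ones: the minors
  divide each other, so their orders agree.\<close>

lemma ord_minor_eq_ord_minor_at:
  fixes A :: "'a::discrete_valuation_ring mat"
  assumes t: "uniformizer t" and A: "A \<in> carrier_mat n m"
    and f: "bij_betw f {..<k} I" "I \<subseteq> {..<n}" and g: "bij_betw g {..<k} J" "J \<subseteq> {..<m}"
  shows "ord_minor t A I J = ord_at t (minor_at A k f g)"
proof -
  have card: "card I = k" "card J = k"
    using f(1) g(1) bij_betw_same_card by fastforce+
  have I: "{i. i < dim_row A \<and> i \<in> I} = I" and J: "{j. j < dim_col A \<and> j \<in> J} = J"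
    using A f(2) g(2) by auto
  have fin: "finite I" "finite J"
    using f(2) g(2) finite_subset by blast+
  have "det (submatrix A I J) = minor_at A k (pick I) (pick J)"
    by (simp add: submatrix_def I J card minor_at_def)
  moreover have pI: "bij_betw (pick I) {..<k} I" and pJ: "bij_betw (pick J) {..<k} J"
    using bij_betw_pick fin card by metis+
  have bd: "f i < n" "pick I i < n" "g i < m" "pick J i < m" if "i < k" for i
    using that subsetD[OF f(2)] subsetD[OF g(2)] bij_betw_apply[OF f(1)] bij_betw_apply[OF g(1)]
      bij_betw_apply[OF pI] bij_betw_apply[OF pJ] by simp_all
  have rows: "minor_at B k h e dvd minor_at B k h' e"
    if "bij_betw h {..<k} X" "bij_betw h' {..<k} X" for B :: "'a mat" and h h' e X
    by (rule minor_at_dvd_same_rows) (use that in \<open>auto simp: bij_betw_def\<close>)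
  have cols: "minor_at A k h e dvd minor_at A k h e'"
    if "bij_betw e {..<k} X" "bij_betw e' {..<k} X" "\<And>i. i < k \<Longrightarrow> h i < n" "X \<subseteq> {..<m}" for h e e' X
  proof -
    have "e i < m" "e' i < m" if "i < k" for i
      using that subsetD[OF \<open>X \<subseteq> {..<m}\<close>] bij_betw_apply[OF \<open>bij_betw e {..<k} X\<close>]
        bij_betw_apply[OF \<open>bij_betw e' {..<k} X\<close>] by simp_all
    then show ?thesis
      using rows[OF that(1,2), of "transpose_mat A" h] minor_at_transpose[OF A that(3)] by simp
  qed
  have "minor_at A k (pick I) (pick J) dvd minor_at A k f g"
    by (rule dvd_trans[OF rows[OF pI f(1)] cols[OF pJ g(1) bd(1) g(2)]])
  moreover have "minor_at A k f g dvd minor_at A k (pick I) (pick J)"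
    by (rule dvd_trans[OF rows[OF f(1) pI] cols[OF g(1) pJ bd(2) g(2)]])
  ultimately show ?thesis
    unfolding ord_minor_def using ord_at_mono_dvd[OF t] by (simp add: antisym)
qed

section \<open>Minors with a gap of rows\<close>

text \<open>Adding the linear function of slope g p - g (p + 1) makes the increment at p vanish; by
  convexity the increments are then nonnegative to the right of p and nonpositive to its left, so p
  is a minimum.\<close>

lemma convex_supporting_line:
  fixes g :: "nat \<Rightarrow> int"
  assumes convex: "\<And>p. p + 2 \<le> n \<Longrightarrow> 2 * g (p + 1) \<le> g p + g (p + 2)"
    and p: "p < n" and q: "q \<le> n"
  shows "g p + (g p - g (p + 1)) * int p \<le> g q + (g p - g (p + 1)) * int q"
proof -
  have slope: "g (i + 1) - g i \<le> g (i + d + 1) - g (i + d)" if "i + d < n" for i d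
    using that
  proof (induction d)
    case (Suc d)
    then show ?case
      using convex[of "i + d"] by simp
  qed simp
  show ?thesis
  proof (cases "p \<le> q")
    case True
    have "g p + (g p - g (p + 1)) * int p \<le> g (p + d) + (g p - g (p + 1)) * int (p + d)"
      if "p + d \<le> n" for d
      using that
    proof (induction d)
      case (Suc d)
      then show ?case
        using slope[of p d] by (simp add: algebra_simps)
    qed simp
    from this[of "q - p"] True q show ?thesis
      by simp
  next
    case False
    have "g p + (g p - g (p + 1)) * int p \<le> g (p - d) + (g p - g (p + 1)) * int (p - d)"
      if "d \<le> p" for d
      using that
    proof (induction d)
      case (Suc d)
      then have eq: "p - d = Suc (p - Suc d)"
        by simp
      have "g (p - Suc d + 1) - g (p - Suc d) \<le> g (p + 1) - g p"
        using slope[of "p - Suc d" "Suc d"] Suc.prems p by simp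
      with Suc show ?case
        unfolding eq by (simp add: algebra_simps)
    qed simp
    from this[of "p - q"] False show ?thesis
      by simp
  qed
qed

text \<open>For a block inside the matrix, these are the rows kept by \<open>Omega\<close> for the
  1-based gap p+1, ..., p+m.\<close>

definition edge_rows :: "nat \<Rightarrow> nat \<Rightarrow> nat \<Rightarrow> nat set" where
  "edge_rows r m p = {..<p} \<union> {m + p..<r}"

lemma card_edge_rows:
  assumes "m + p \<le> r"
  shows "card (edge_rows r m p) = r - m"
proof -
  have "card (edge_rows r m p) = p + (r - (m + p))"
    unfolding edge_rows_def by (subst card_Un_disjoint) auto
  with assms show ?thesis
    by simp
qed

lemma edge_rows_subset: "m + p \<le> r \<Longrightarrow> edge_rows r m p \<subseteq> {..<r}"
  by (auto simp: edge_rows_def)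

text \<open>\<open>\<omega> I\<close> is the order of the minor of a generic matrix with rows \<open>I\<close> and right-most columns;
  the slopes of \<open>tail_order m\<close> are the negatives of the parts \<open>\<mu>\<^sub>j + k\<^sub>1\<^sub>j + \<dots> + k\<^sub>m\<^sub>j\<close>.\<close>

locale generic_orders =
  fixes r :: nat and \<mu> :: "nat list" and \<omega> :: "nat set \<Rightarrow> nat"
  assumes length_\<mu>: "length \<mu> = r" and sorted_\<mu>: "sorted_wrt (\<ge>) \<mu>"
    and mono: "\<And>I H. I \<subseteq> {..<r} \<Longrightarrow> H \<subseteq> {..<r} \<Longrightarrow> index_le I H \<Longrightarrow> \<omega> I \<le> \<omega> H"
    and weighted_antimono: "\<And>I H. I \<subseteq> {..<r} \<Longrightarrow> H \<subseteq> {..<r} \<Longrightarrow> index_le I H \<Longrightarrow>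
      \<omega> H + part_sum \<mu> H \<le> \<omega> I + part_sum \<mu> I"
    and pluecker: "\<And>K x y z. K \<subseteq> {..<r} \<Longrightarrow> {x, y, z} \<subseteq> {..<r} - K \<Longrightarrow>
      x \<noteq> y \<Longrightarrow> x \<noteq> z \<Longrightarrow> y \<noteq> z \<Longrightarrow>
      min (\<omega> (insert y K) + \<omega> (insert x (insert z K))) (\<omega> (insert z K) + \<omega> (insert x (insert y K)))
        \<le> \<omega> (insert x K) + \<omega> (insert y (insert z K))"
begin

definition tail_order :: "nat \<Rightarrow> nat \<Rightarrow> nat" where
  "tail_order m p = \<omega> (edge_rows r m p) + (\<Sum>i = m + p..<r. \<mu> ! i)"

section \<open>Row exchanges and the Littlewood-Richardson inequalities\<close>

lemma swap_mono:
  assumes "K \<subseteq> {..<r}" "a \<notin> K" "b \<notin> K" "a \<le> b" "b < r"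
  shows "\<omega> (insert a K) \<le> \<omega> (insert b K)"
    and "\<omega> (insert b K) + \<mu> ! b \<le> \<omega> (insert a K) + \<mu> ! a"
proof -
  have fin: "finite K"
    using assms(1) finite_subset by blast
  have "insert a K \<subseteq> {..<r}" "insert b K \<subseteq> {..<r}"
    using assms by auto
  note sub = this index_le_insert_mono[OF fin assms(2-4)]
  show "\<omega> (insert a K) \<le> \<omega> (insert b K)"
    by (rule mono[OF sub])
  show "\<omega> (insert b K) + \<mu> ! b \<le> \<omega> (insert a K) + \<mu> ! a"
    using weighted_antimono[OF sub] fin assms(2,3) by (simp add: part_sum_def)
qed

text \<open>Exchanging row m + p for row p lowers \<omega>, and the tail loses the part of row m +
  p. It is what makes the supporting slope a natural number, usable as a truncation
  exponent.\<close>

lemma tail_order_decreasing: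
  assumes "m + p < r"
  shows "tail_order m (p + 1) \<le> tail_order m p"
proof -
  let ?K = "{..<p} \<union> {m + p + 1..<r}"
  have e: "edge_rows r m p = insert (m + p) ?K" "edge_rows r m (p + 1) = insert p ?K"
    using assms by (auto simp: edge_rows_def)
  have "\<omega> (insert p ?K) \<le> \<omega> (insert (m + p) ?K)"
    by (rule swap_mono(1)) (use assms in auto)
  moreover have "(\<Sum>i = m + p..<r. \<mu> ! i) = \<mu> ! (m + p) + (\<Sum>i = m + p + 1..<r. \<mu> ! i)"
    using assms by (simp add: sum.atLeast_Suc_lessThan)
  ultimately show ?thesis
    unfolding tail_order_def e by simp
qed

text \<open>Column strictness \<mu>_(j+1) + S_m(j+1) <= \<mu>_j + S_(m-1)(j) for j = m + p + 1,
  where S_i(j) = k_1j + ... + k_ij. Whichever term attains the minimum in the Pluecker inequality,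
  one weighted exchange of the adjacent rows b and c finishes. For m = 1 the rows a and b coincide
  and the exchange alone suffices.\<close>

lemma edge_rows_column_strict:
  assumes "0 < m" "m + p + 2 \<le> r"
  shows "\<omega> (edge_rows r m (p + 1)) + \<omega> (edge_rows r (m - 1) (p + 2)) + \<mu> ! (m + p + 1)
    \<le> \<omega> (edge_rows r m (p + 2)) + \<omega> (edge_rows r (m - 1) (p + 1)) + \<mu> ! (m + p)"
proof -
  let ?K = "{..<p + 1} \<union> {m + p + 2..<r}"
  let ?a = "p + 1" and ?b = "m + p" and ?c = "m + p + 1"
  have e: "edge_rows r m (p + 1) = insert ?c ?K"
    "edge_rows r m (p + 2) = insert ?a ?K"
    "edge_rows r (m - 1) (p + 1) = insert ?b (insert ?c ?K)"
    "edge_rows r (m - 1) (p + 2) = insert ?a (insert ?c ?K)"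
    using assms by (auto simp: edge_rows_def)
  have bc: "\<omega> (insert ?c L) + \<mu> ! ?c \<le> \<omega> (insert ?b L) + \<mu> ! ?b"
    if "L \<subseteq> {..<r}" "?b \<notin> L" "?c \<notin> L" for L
    by (rule swap_mono(2)) (use that assms in auto)
  have bc1: "\<omega> (insert ?c ?K) + \<mu> ! ?c \<le> \<omega> (insert ?b ?K) + \<mu> ! ?b"
    by (rule bc) (use assms in auto)
  show ?thesis
  proof (cases "m = 1")
    case True
    then show ?thesis
      using bc1 unfolding e by simp
  next
    case False
    have "\<omega> (insert ?c (insert ?a ?K)) + \<mu> ! ?c \<le> \<omega> (insert ?b (insert ?a ?K)) + \<mu> ! ?b"
      by (rule bc) (use False assms in auto)
    moreover have "min (\<omega> (insert ?b ?K) + \<omega> (insert ?a (insert ?c ?K)))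
        (\<omega> (insert ?c ?K) + \<omega> (insert ?a (insert ?b ?K)))
      \<le> \<omega> (insert ?a ?K) + \<omega> (insert ?b (insert ?c ?K))"
      by (rule pluecker) (use False assms in auto)
    ultimately show ?thesis
      unfolding e using bc1 by (simp only: insert_commute[of ?a])
  qed
qed

text \<open>This is k_mj >= 0 for j = m + p + 1. Both terms of the Pluecker minimum dominate the
  left side after exchanging p + 1 for p in one factor. For m = 1 the rows p + 1 and m + p
  coincide.\<close>

lemma edge_rows_strip_nonneg:
  assumes "0 < m" "m + p + 1 \<le> r"
  shows "\<omega> (edge_rows r m (p + 1)) + \<omega> (edge_rows r (m - 1) (p + 1))
    \<le> \<omega> (edge_rows r m p) + \<omega> (edge_rows r (m - 1) (p + 2))"
proof -
  let ?K = "{..<p} \<union> {m + p + 1..<r}"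
  let ?a = "p" and ?a' = "p + 1" and ?b = "m + p"
  have e: "edge_rows r m p = insert ?b ?K"
    "edge_rows r m (p + 1) = insert ?a ?K"
    "edge_rows r (m - 1) (p + 1) = insert ?b (insert ?a ?K)"
    "edge_rows r (m - 1) (p + 2) = insert ?a (insert ?a' ?K)"
    using assms by (auto simp: edge_rows_def)
  show ?thesis
  proof (cases "m = 1")
    case True
    have "\<omega> (insert ?a ?K) \<le> \<omega> (insert ?b ?K)"
      by (rule swap_mono(1)) (use assms in auto)
    with True show ?thesis
      unfolding e by (simp add: insert_commute)
  next
    case False
    have "\<omega> (insert ?a ?K) \<le> \<omega> (insert ?a' ?K)"
      by (rule swap_mono(1)) (use False assms in auto)
    moreover have "\<omega> (insert ?a (insert ?b ?K)) \<le> \<omega> (insert ?a' (insert ?b ?K))"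
      by (rule swap_mono(1)) (use False assms in auto)
    moreover have "min (\<omega> (insert ?a ?K) + \<omega> (insert ?b (insert ?a' ?K)))
        (\<omega> (insert ?a' ?K) + \<omega> (insert ?b (insert ?a ?K)))
      \<le> \<omega> (insert ?b ?K) + \<omega> (insert ?a (insert ?a' ?K))"
      by (rule pluecker) (use False assms in auto)
    ultimately show ?thesis
      unfolding e by (simp only: insert_commute[of ?b])
  qed
qed

text \<open>Adding column strictness and nonnegativity cancels the orders with gap length m - 1. For
  m = 0 all row sets are full and only the monotonicity of \<mu> is left.\<close>

lemma tail_order_convex:
  assumes "m + p + 2 \<le> r"
  shows "2 * tail_order m (p + 1) \<le> tail_order m p + tail_order m (p + 2)"
proof -
  have tail: "(\<Sum>i = m + p..<r. \<mu> ! i) = \<mu> ! (m + p) + (\<Sum>i = m + p + 1..<r. \<mu> ! i)"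
    "(\<Sum>i = m + p + 1..<r. \<mu> ! i) = \<mu> ! (m + p + 1) + (\<Sum>i = m + p + 2..<r. \<mu> ! i)"
    using assms by (simp_all add: sum.atLeast_Suc_lessThan)
  have "2 * \<omega> (edge_rows r m (p + 1)) + \<mu> ! (m + p + 1)
      \<le> \<omega> (edge_rows r m p) + \<omega> (edge_rows r m (p + 2)) + \<mu> ! (m + p)"
  proof (cases "m = 0")
    case True
    have "edge_rows r m p = {..<r}" "edge_rows r m (p + 1) = {..<r}" "edge_rows r m (p + 2) = {..<r}"
      using assms True by (auto simp: edge_rows_def)
    moreover have "\<mu> ! (m + p + 1) \<le> \<mu> ! (m + p)"
      using sorted_wrt_nth_less[OF sorted_\<mu>, of "m + p" "m + p + 1"] length_\<mu> assms by simp
    ultimately show ?thesis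
      by simp
  next
    case False
    then show ?thesis
      using edge_rows_column_strict[of m p] edge_rows_strip_nonneg[of m p] assms by simp
  qed
  then show ?thesis
    unfolding tail_order_def using tail by (simp add: add.assoc)
qed

lemma tail_order_supporting_line:
  assumes "m + p \<le> r"
  obtains c where "\<And>q. m + q \<le> r \<Longrightarrow> tail_order m p + c * p \<le> tail_order m q + c * q"
proof (cases "m + p = r")
  case True
  \<comment> \<open>At the right end there is no next value to define a slope, but a decreasing
    function is least there, so c = 0 works.\<close>
  have "tail_order m (q + d) \<le> tail_order m q" if "m + q + d \<le> r" for q d
    using that
  proof (induction d)
    case (Suc d)
    then show ?case
      using tail_order_decreasing[of m "q + d"] by simp
  qed simp
  from this[of _ "p - _"] True have "tail_order m p \<le> tail_order m q" if "m + q \<le> r" for q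
    using that by (metis add_diff_inverse_nat add_le_cancel_left leD le_refl group_cancel.add1 add.assoc)
  then show ?thesis
    using that[of 0] by simp
next
  case False
  let ?c = "int (tail_order m p) - int (tail_order m (p + 1))"
  have line: "int (tail_order m p) + ?c * int p \<le> int (tail_order m q) + ?c * int q"
    if "m + q \<le> r" for q
  proof (rule convex_supporting_line[of "r - m" "\<lambda>p. int (tail_order m p)"])
    fix i assume "i + 2 \<le> r - m"
    then have "m + i + 2 \<le> r"
      by simp
    from tail_order_convex[OF this]
    show "2 * int (tail_order m (i + 1)) \<le> int (tail_order m i) + int (tail_order m (i + 2))"
      by linarith
  qed (use False assms that in auto)
  have c: "int (tail_order m p - tail_order m (p + 1)) = ?c"
    using tail_order_decreasing[of m p] False assms by simp
  show ?thesis
  proof (rule that[of "tail_order m p - tail_order m (p + 1)"])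
    fix q assume "m + q \<le> r"
    from line[OF this, folded c]
    show "tail_order m p + (tail_order m p - tail_order m (p + 1)) * p
        \<le> tail_order m q + (tail_order m p - tail_order m (p + 1)) * q"
      by (metis of_nat_add of_nat_le_iff of_nat_mult)
  qed
qed

text \<open>Lower bound in the Legendre identity, by two moves. The rows of \<open>H\<close> whose
  parts are at least c all cost c, so pushing them to the top keeps the cost and lowers \<omega>.
  The other rows cost their full parts, so pushing them to the bottom lowers \<omega> plus
  \<open>part_sum\<close>.\<close>

lemma tail_order_le_truncated:
  assumes H: "H \<subseteq> {..<r}" "card H = r - m" and m: "m \<le> r"
  obtains p where "m + p \<le> r" "tail_order m p + c * p \<le> \<omega> H + (\<Sum>h\<in>H. min (\<mu> ! h) c)"
proof -
  have fin: "finite H"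
    using H(1) finite_subset by blast
  have dec: "\<mu> ! j \<le> \<mu> ! i" if "i \<le> j" "j < r" for i j
    using sorted_wrt_nth_less[OF sorted_\<mu>, of i j] length_\<mu> that by (cases "i = j") auto
  \<comment> \<open>The threshold between the two groups; the alternative i = r covers the case that
    no part is below c.\<close>
  define s where "s = (LEAST i. i = r \<or> \<mu> ! i < c)"
  have s: "s = r \<or> \<mu> ! s < c"
    unfolding s_def by (rule LeastI[of _ r]) simp
  have "s \<le> r"
    unfolding s_def by (rule Least_le) simp
  have low: "c \<le> \<mu> ! i" if "i < s" for i
    using not_less_Least[of i "\<lambda>i. i = r \<or> \<mu> ! i < c"] that unfolding s_def by auto
  have high: "\<mu> ! i \<le> c" if "s \<le> i" "i < r" for i
    using s dec[OF that] that by auto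
  define p where "p = card (H \<inter> {..<s})"
  define B where "B = H - {..<s}"
  have H_split: "H = (H \<inter> {..<s}) \<union> B" "(H \<inter> {..<s}) \<inter> B = {}"
    by (auto simp: B_def)
  have cardB: "card H = p + card B"
    unfolding p_def B_def using card_Int_Diff[OF fin] .
  have "p \<le> s"
    unfolding p_def using card_mono[of "{..<s}" "H \<inter> {..<s}"] by simp
  have mp: "m + p \<le> r" and cB: "card B = r - (m + p)"
    using cardB H(2) m by simp_all
  have B: "B \<subseteq> {s..<r}" and finB: "finite B"
    using H(1) fin by (auto simp: B_def)
  define I where "I = {..<p} \<union> B"
  have disj: "{..<p} \<inter> B = {}"
    using B \<open>p \<le> s\<close> by auto
  have I: "I \<subseteq> {..<r}" "finite I" "card I = r - m"
    using B finB disj \<open>p \<le> s\<close> \<open>s \<le> r\<close> mp cB unfolding I_def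
    by (auto simp: card_Un_disjoint)
  have "index_le I H"
  proof (rule index_leI_counting)
    fix i
    have "card (H \<inter> {..<s} \<inter> {..<i}) \<le> card ({..<p} \<inter> {..<i})"
    proof -
      have "card (H \<inter> {..<s} \<inter> {..<i}) \<le> p"
        unfolding p_def by (rule card_mono) (use fin in auto)
      moreover have "card (H \<inter> {..<s} \<inter> {..<i}) \<le> i"
        using card_mono[of "{..<i}" "H \<inter> {..<s} \<inter> {..<i}"] by simp
      moreover have "{..<p} \<inter> {..<i} = {..<min p i}"
        by auto
      ultimately show ?thesis
        by simp
    qed
    moreover have "card (H \<inter> {..<i}) = card (H \<inter> {..<s} \<inter> {..<i}) + card (B \<inter> {..<i})"
      using fin finB H_split(2)
      by (subst card_Un_disjoint[symmetric]) (auto simp: B_def intro!: arg_cong[of _ _ card])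
    moreover have "card (I \<inter> {..<i}) = card ({..<p} \<inter> {..<i}) + card (B \<inter> {..<i})"
      unfolding I_def Int_Un_distrib2 by (rule card_Un_disjoint) (use finB disj in auto)
    ultimately show "card (H \<inter> {..<i}) \<le> card (I \<inter> {..<i})"
      by simp
  qed (use fin I H in auto)
  then have "\<omega> I \<le> \<omega> H"
    using mono I H by blast
  have "index_le I (edge_rows r m p)"
  proof (rule index_leI_counting)
    fix i
    have "card ({m + p..<r} \<inter> {..<i}) \<le> card (B \<inter> {..<i})"
    proof -
      have "card B = card (B \<inter> {..<i}) + card (B - {..<i})"
        using card_Int_Diff[OF finB] .
      moreover have "card (B - {..<i}) \<le> card {i..<r}"
        by (rule card_mono) (use B in auto)
      moreover have "{m + p..<r} \<inter> {..<i} = {m + p..<min r i}"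
        by auto
      ultimately show ?thesis
        using cB by simp
    qed
    moreover have "card (edge_rows r m p \<inter> {..<i})
        = card ({..<p} \<inter> {..<i}) + card ({m + p..<r} \<inter> {..<i})"
      unfolding edge_rows_def Int_Un_distrib2 by (rule card_Un_disjoint) auto
    moreover have "card (I \<inter> {..<i}) = card ({..<p} \<inter> {..<i}) + card (B \<inter> {..<i})"
      unfolding I_def Int_Un_distrib2 by (rule card_Un_disjoint) (use finB disj in auto)
    ultimately show "card (edge_rows r m p \<inter> {..<i}) \<le> card (I \<inter> {..<i})"
      by simp
  qed (use I card_edge_rows[OF mp] in \<open>auto simp: edge_rows_def\<close>)
  then have "\<omega> (edge_rows r m p) + part_sum \<mu> (edge_rows r m p) \<le> \<omega> I + part_sum \<mu> I"
    using weighted_antimono I(1) edge_rows_subset[OF mp] by blast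
  moreover have "part_sum \<mu> (edge_rows r m p) = (\<Sum>i<p. \<mu> ! i) + (\<Sum>i = m + p..<r. \<mu> ! i)"
    unfolding part_sum_def edge_rows_def by (rule sum.union_disjoint) auto
  moreover have "part_sum \<mu> I = (\<Sum>i<p. \<mu> ! i) + (\<Sum>i\<in>B. \<mu> ! i)"
    unfolding part_sum_def I_def by (rule sum.union_disjoint) (use finB disj in auto)
  moreover have "(\<Sum>h\<in>H. min (\<mu> ! h) c) = c * p + (\<Sum>i\<in>B. \<mu> ! i)"
  proof -
    have "(\<Sum>h\<in>H. min (\<mu> ! h) c)
        = (\<Sum>h\<in>H \<inter> {..<s}. min (\<mu> ! h) c) + (\<Sum>h\<in>B. min (\<mu> ! h) c)"
      by (subst H_split(1), rule sum.union_disjoint) (use fin finB H_split(2) in auto)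
    also have "(\<Sum>h\<in>H \<inter> {..<s}. min (\<mu> ! h) c) = (\<Sum>h\<in>H \<inter> {..<s}. c)"
      by (rule sum.cong) (use low in auto)
    also have "\<dots> = c * p"
      by (simp add: p_def)
    also have "(\<Sum>h\<in>B. min (\<mu> ! h) c) = (\<Sum>h\<in>B. \<mu> ! h)"
    proof (rule sum.cong)
      fix h assume "h \<in> B"
      then show "min (\<mu> ! h) c = \<mu> ! h"
        using high[of h] subsetD[OF B] by simp
    qed simp
    finally show ?thesis .
  qed
  ultimately show thesis
    using that[OF mp] \<open>\<omega> I \<le> \<omega> H\<close> by (simp add: tail_order_def)
qed

text \<open>Upper bound in the Legendre identity: bound the minimum by c on the leading rows and by
  the part on the tail.\<close>

lemma truncated_edge_le:
  assumes "m + p \<le> r"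
  shows "\<omega> (edge_rows r m p) + (\<Sum>h\<in>edge_rows r m p. min (\<mu> ! h) c) \<le> tail_order m p + c * p"
proof -
  have "(\<Sum>h\<in>edge_rows r m p. min (\<mu> ! h) c)
      = (\<Sum>h<p. min (\<mu> ! h) c) + (\<Sum>h = m + p..<r. min (\<mu> ! h) c)"
    unfolding edge_rows_def by (rule sum.union_disjoint) auto
  moreover have "(\<Sum>h<p. min (\<mu> ! h) c) \<le> c * p"
    using sum_bounded_above[of "{..<p}" "\<lambda>h. min (\<mu> ! h) c" c] by (simp add: mult.commute)
  moreover have "(\<Sum>h = m + p..<r. min (\<mu> ! h) c) \<le> (\<Sum>h = m + p..<r. \<mu> ! h)"
    by (rule sum_mono) simp
  ultimately show ?thesis
    by (simp add: tail_order_def)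
qed

end

section \<open>Generic matrices and pair equivalence\<close>

lemma GL_carrier: "A \<in> GL r \<Longrightarrow> A \<in> carrier_mat r r"
  by (simp add: GL_def)

lemma is_inverse_mat_sym: "is_inverse_mat r Q Q' \<Longrightarrow> is_inverse_mat r Q' Q"
  by (auto simp: is_inverse_mat_def)

lemma is_inverse_matD:
  assumes "is_inverse_mat r Q Q'"
  shows "Q \<in> carrier_mat r r" "Q' \<in> carrier_mat r r" "Q * Q' = 1\<^sub>m r" "Q' * Q = 1\<^sub>m r"
  using assms by (auto simp: is_inverse_mat_def inverts_mat_def)

lemma GL_inverse:
  assumes "P \<in> GL r"
  obtains P' where "is_inverse_mat r P P'"
proof -
  obtain P' where P': "inverts_mat P P'" "inverts_mat P' P" and P: "P \<in> carrier_mat r r"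
    using assms by (auto simp: GL_def invertible_mat_def)
  \<comment> \<open>\<open>invertible_mat\<close> does not prescribe the shape of the inverse; it is
    read off from the two product identities.\<close>
  have "dim_col (P * P') = r"
    using P' P by (simp add: inverts_mat_def)
  moreover have "dim_row P' = dim_col (P' * P)"
    using P' by (simp add: inverts_mat_def)
  ultimately have "P' \<in> carrier_mat r r"
    using P by auto
  then show thesis
    using that P P' by (simp add: is_inverse_mat_def)
qed

lemma is_inverse_mat_GL: "is_inverse_mat r Q Q' \<Longrightarrow> Q \<in> GL r"
  unfolding is_inverse_mat_def GL_def invertible_mat_def by auto

lemma is_inverse_mat_mult:
  assumes P: "is_inverse_mat r P P'" and Q: "is_inverse_mat r Q Q'"
  shows "is_inverse_mat r (P * Q) (Q' * P')"
proof -
  note p = is_inverse_matD[OF P] and q = is_inverse_matD[OF Q]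
  have "P * Q * (Q' * P') = P * ((Q * Q') * P')"
    using p(1,2) q(1,2) by (simp add: assoc_mult_mat[of _ r r _ r _ r])
  moreover have "Q' * P' * (P * Q) = Q' * ((P' * P) * Q)"
    using p(1,2) q(1,2) by (simp add: assoc_mult_mat[of _ r r _ r _ r])
  ultimately show ?thesis
    using p q by (simp add: is_inverse_mat_def inverts_mat_def)
qed

lemma det_GL_nonzero:
  fixes A :: "'a::idom mat"
  assumes "A \<in> GL r"
  shows "det A \<noteq> 0"
proof -
  obtain A' where "is_inverse_mat r A A'"
    using GL_inverse[OF assms] .
  note A' = is_inverse_matD[OF this]
  have "det A * det A' = 1"
    using det_mult[OF A'(1,2)] A'(3) by simp
  then show ?thesis
    by auto
qed

lemma pair_equiv_sym:
  assumes "pair_equiv r (M, N) (M', N')" "M \<in> carrier_mat r r" "N \<in> carrier_mat r r"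
  shows "pair_equiv r (M', N') (M, N)"
proof -
  obtain P Q Q' T T' where P: "P \<in> GL r" and Q: "is_inverse_mat r Q Q'" and T: "is_inverse_mat r T T'"
    and e: "M' = P * M * Q'" "N' = Q * N * T'"
    using assms(1) by (auto simp: pair_equiv_def)
  obtain P' where P': "is_inverse_mat r P P'"
    using GL_inverse[OF P] .
  note p = is_inverse_matD[OF P'] and q = is_inverse_matD[OF Q] and u = is_inverse_matD[OF T]
  have "P' * M' * Q = (P' * P) * M * (Q' * Q)" "Q' * N' * T = (Q' * Q) * N * (T' * T)"
    unfolding e using p(1,2) q(1,2) u(1,2) assms(2,3)
    by (simp_all add: assoc_mult_mat[of _ r r _ r _ r])
  then have "M = P' * M' * Q" "N = Q' * N' * T"
    using p q u assms(2,3) by simp_all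
  then show ?thesis
    unfolding pair_equiv_def prod.case
    using is_inverse_mat_GL[OF is_inverse_mat_sym[OF P']] is_inverse_mat_sym[OF Q] is_inverse_mat_sym[OF T]
    by blast
qed

lemma pair_equiv_trans:
  assumes "pair_equiv r (M, N) (M', N')" "pair_equiv r (M', N') (M'', N'')"
    and "M \<in> carrier_mat r r" "N \<in> carrier_mat r r"
  shows "pair_equiv r (M, N) (M'', N'')"
proof -
  obtain P Q Q' T T' where P: "P \<in> GL r" and Q: "is_inverse_mat r Q Q'" and T: "is_inverse_mat r T T'"
    and e: "M' = P * M * Q'" "N' = Q * N * T'"
    using assms(1) by (auto simp: pair_equiv_def)
  obtain V U U' S S' where V: "V \<in> GL r" and U: "is_inverse_mat r U U'" and S: "is_inverse_mat r S S'"
    and e': "M'' = V * M' * U'" "N'' = U * N' * S'"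
    using assms(2) by (auto simp: pair_equiv_def)
  obtain P' V' where P': "is_inverse_mat r P P'" and V': "is_inverse_mat r V V'"
    using GL_inverse P V by metis
  have "M'' = (V * P) * M * (Q' * U')" "N'' = (U * Q) * N * (T' * S')"
    unfolding e' e
    using is_inverse_matD(1,2)[OF P'] is_inverse_matD(1,2)[OF V'] is_inverse_matD(1,2)[OF Q]
      is_inverse_matD(1,2)[OF T] is_inverse_matD(1,2)[OF U] is_inverse_matD(1,2)[OF S] assms(3,4)
    by (simp_all add: assoc_mult_mat[of _ r r _ r _ r])
  then show ?thesis
    unfolding pair_equiv_def prod.case
    using is_inverse_mat_GL[OF is_inverse_mat_mult[OF V' P']] is_inverse_mat_mult[OF U Q]
      is_inverse_mat_mult[OF S T] by blast
qed

lemma D_mat_carrier: "D_mat t \<mu> \<in> carrier_mat (length \<mu>) (length \<mu>)"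
  by (simp add: D_mat_def)

text \<open>The relation D = P D Q^(-1) rearranges to P D = D Q, the division-free way of saying
  that Q stays integral under conjugation by D.\<close>

lemma pair_equiv_D_matE:
  assumes "pair_equiv r (D_mat t \<mu>, A) (D_mat t \<mu>, A')" "length \<mu> = r" "A \<in> carrier_mat r r"
  obtains W Q T' where "W \<in> carrier_mat r r" "Q \<in> carrier_mat r r" "T' \<in> carrier_mat r r"
    "W * D_mat t \<mu> = D_mat t \<mu> * Q" "A' = Q * A * T'"
proof -
  obtain P Q Q' T T' where P: "P \<in> GL r" and Q: "is_inverse_mat r Q Q'" and T: "is_inverse_mat r T T'"
    and e: "D_mat t \<mu> = P * D_mat t \<mu> * Q'" "A' = Q * A * T'"
    using assms(1) by (auto simp: pair_equiv_def)
  note q = is_inverse_matD[OF Q]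
  have D: "D_mat t \<mu> \<in> carrier_mat r r"
    using D_mat_carrier[of t \<mu>] assms(2) by simp
  have "D_mat t \<mu> * Q = P * D_mat t \<mu> * (Q' * Q)"
    by (subst e(1)) (use GL_carrier[OF P] D q(1,2) in \<open>simp add: assoc_mult_mat[of _ r r _ r _ r]\<close>)
  also have "\<dots> = P * D_mat t \<mu>"
    using GL_carrier[OF P] D q(4) by simp
  finally show thesis
    using that[OF GL_carrier[OF P] q(1) is_inverse_matD(2)[OF T]] e(2) by simp
qed

section \<open>Monotonicity of the minor orders of a generic matrix\<close>

lemma mu_genericE:
  fixes A :: "'a::idom mat"
  assumes "mu_generic t \<mu> A"
  obtains B B' C where "A \<in> carrier_mat (length \<mu>) (length \<mu>)" "det A \<noteq> 0"
    and "\<forall>I J. I \<subseteq> {..<length \<mu>} \<longrightarrow> J \<subseteq> {..<length \<mu>} \<longrightarrow> card I = card J \<longrightarrow>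
      ord_minor t A I J = (MIN S \<in> {S. S \<subseteq> {..<length \<mu>} \<and> index_le I S}. ord_minor t B S J)"
    and "\<forall>I J. I \<subseteq> {..<length \<mu>} \<longrightarrow> J \<subseteq> {..<length \<mu>} \<longrightarrow> card I = card J \<longrightarrow>
      ord_minor t A I J = (MIN H \<in> {H. H \<subseteq> {..<length \<mu>} \<and> index_le H I}.
        ord_minor t B' H J + enat (part_sum \<mu> H) - enat (part_sum \<mu> I))"
    and "\<forall>I J. I \<subseteq> {..<length \<mu>} \<longrightarrow> J \<subseteq> {..<length \<mu>} \<longrightarrow> card I = card J \<longrightarrow>
      ord_minor t A I J = (MIN H \<in> {H. H \<subseteq> {..<length \<mu>} \<and> index_le H J}. ord_minor t C I H)"
proof -
  let ?r = "length \<mu>"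
  obtain N QU QL TL TU QUh where
    N: "N \<in> full_rank_mats ?r" and adm: "admissible t \<mu> QU" "admissible t \<mu> QL"
    and T: "TU \<in> GL ?r" "TL \<in> GL ?r" and A: "A = (QU * QL) * N * (TL * TU)"
    and gen: "\<forall>I J. I \<subseteq> {..<?r} \<and> J \<subseteq> {..<?r} \<and> card I = card J \<longrightarrow>
      ord_minor t ((QU * QL) * N * (TL * TU)) I J
        = (MIN S \<in> {S. S \<subseteq> {..<?r} \<and> index_le I S}. ord_minor t (QL * N * (TL * TU)) S J) \<and>
      ord_minor t ((QU * QL) * N * (TL * TU)) I J
        = (MIN H \<in> {H. H \<subseteq> {..<?r} \<and> index_le H I}.
             ord_minor t (QUh * N * (TL * TU)) H J + enat (part_sum \<mu> H) - enat (part_sum \<mu> I)) \<and>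
      ord_minor t ((QU * QL) * N * (TL * TU)) I J
        = (MIN H \<in> {H. H \<subseteq> {..<?r} \<and> index_le H J}. ord_minor t ((QU * QL) * N * TL) I H)"
    using assms unfolding mu_generic_def Let_def by (elim exE conjE) blast
  have GL: "QU \<in> GL ?r" "QL \<in> GL ?r"
    using adm by (simp_all add: admissible_def)
  have N': "N \<in> carrier_mat ?r ?r" "det N \<noteq> 0"
    using N by (simp_all add: full_rank_mats_def)
  note c = GL_carrier[OF GL(1)] GL_carrier[OF GL(2)] N'(1) GL_carrier[OF T(1)] GL_carrier[OF T(2)]
  have "A \<in> carrier_mat ?r ?r"
    unfolding A by (intro mult_carrier_mat[of _ _ ?r] c)
  moreover have "det A = det QU * det QL * det N * (det TL * det TU)"
    unfolding A using c by (simp add: det_mult[of _ ?r])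
  then have "det A \<noteq> 0"
    using GL[THEN det_GL_nonzero] T[THEN det_GL_nonzero] N'(2) by simp
  ultimately show thesis
    by (rule that) (use gen[folded A] in blast)+
qed

lemma mu_generic_carrier:
  fixes A :: "'a::idom mat"
  assumes "mu_generic t \<mu> A"
  shows "A \<in> carrier_mat (length \<mu>) (length \<mu>)"
  by (rule mu_genericE[OF assms])

lemma mu_generic_det_nonzero:
  fixes A :: "'a::idom mat"
  assumes "mu_generic t \<mu> A"
  shows "det A \<noteq> 0"
  by (rule mu_genericE[OF assms])

lemma finite_index_sets: "finite {S. S \<subseteq> {..<r::nat} \<and> P S}"
  by (rule finite_subset[of _ "Pow {..<r}"]) auto

text \<open>The order for \<open>I\<close> is a minimum over all sets above \<open>I\<close>, of a
  quantity independent of \<open>I\<close>. Transitivity puts the sets above \<open>H\<close> among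
  these, and enlarging the range lowers the minimum.\<close>

lemma mu_generic_minor_mono:
  assumes gen: "mu_generic t \<mu> A" and sub: "I \<subseteq> {..<length \<mu>}" "H \<subseteq> {..<length \<mu>}" "J \<subseteq> {..<length \<mu>}"
    and card: "card I = card J" and le: "index_le I H"
  shows "ord_minor t A I J \<le> ord_minor t A H J"
proof -
  obtain B where B0: "\<forall>I J. I \<subseteq> {..<length \<mu>} \<longrightarrow> J \<subseteq> {..<length \<mu>} \<longrightarrow> card I = card J \<longrightarrow>
      ord_minor t A I J = (MIN S \<in> {S. S \<subseteq> {..<length \<mu>} \<and> index_le I S}. ord_minor t B S J)"
    by (rule mu_genericE[OF gen]) (rule that, assumption)
  note B = B0[rule_format]
  have "card H = card J"
    using le card by (simp add: index_le_def)
  then show ?thesis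
    unfolding B[OF sub(1,3) card] B[OF sub(2,3) \<open>card H = card J\<close>]
    by (intro Min_antimono) (use index_le_trans[OF le] index_le_refl sub finite_index_sets in auto)
qed

lemma mu_generic_minor_column_antimono:
  assumes gen: "mu_generic t \<mu> A" and sub: "I \<subseteq> {..<length \<mu>}" "J \<subseteq> {..<length \<mu>}" "H \<subseteq> {..<length \<mu>}"
    and card: "card I = card J" and le: "index_le J H"
  shows "ord_minor t A I H \<le> ord_minor t A I J"
proof -
  obtain C where C0: "\<forall>I J. I \<subseteq> {..<length \<mu>} \<longrightarrow> J \<subseteq> {..<length \<mu>} \<longrightarrow> card I = card J \<longrightarrow>
      ord_minor t A I J = (MIN H \<in> {H. H \<subseteq> {..<length \<mu>} \<and> index_le H J}. ord_minor t C I H)"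
    by (rule mu_genericE[OF gen]) (rule that, assumption)
  note C = C0[rule_format]
  have "card I = card H"
    using le card by (simp add: index_le_def)
  then show ?thesis
    unfolding C[OF sub(1,2) card] C[OF sub(1,3) \<open>card I = card H\<close>]
    by (intro Min_antimono) (use index_le_trans[OF _ le] index_le_refl sub finite_index_sets in auto)
qed

text \<open>Adding \<open>part_sum \<mu> I\<close> back makes the minimized quantity independent of
  \<open>I\<close>, and the sets below \<open>I\<close> are among those below \<open>H\<close>. A
  minimizer \<open>S\<close> for \<open>I\<close> therefore also competes for
  \<open>H\<close>.\<close>

lemma mu_generic_weighted_minor_antimono:
  assumes gen: "mu_generic t \<mu> A" and \<mu>: "sorted_wrt (\<ge>) \<mu>"
    and sub: "I \<subseteq> {..<length \<mu>}" "H \<subseteq> {..<length \<mu>}" "J \<subseteq> {..<length \<mu>}"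
    and card: "card I = card J" and le: "index_le I H"
  shows "ord_minor t A H J + enat (part_sum \<mu> H) \<le> ord_minor t A I J + enat (part_sum \<mu> I)"
proof -
  obtain B where B0: "\<forall>I J. I \<subseteq> {..<length \<mu>} \<longrightarrow> J \<subseteq> {..<length \<mu>} \<longrightarrow> card I = card J \<longrightarrow>
      ord_minor t A I J = (MIN H \<in> {H. H \<subseteq> {..<length \<mu>} \<and> index_le H I}.
        ord_minor t B H J + enat (part_sum \<mu> H) - enat (part_sum \<mu> I))"
    by (rule mu_genericE[OF gen]) (rule that, assumption)
  note B = B0[rule_format]
  have cancel: "x + enat (part_sum \<mu> S) - enat (part_sum \<mu> X) + enat (part_sum \<mu> X) = x + enat (part_sum \<mu> S)"
    if "S \<subseteq> {..<length \<mu>}" "X \<subseteq> {..<length \<mu>}" "index_le S X" for x S X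
    using part_sum_antimono[OF \<mu> that(2,1,3)] by (cases x) auto
  let ?F = "\<lambda>X S. ord_minor t B S J + enat (part_sum \<mu> S) - enat (part_sum \<mu> X)"
  let ?\<S> = "\<lambda>X. {S. S \<subseteq> {..<length \<mu>} \<and> index_le S X}"
  have cardH: "card H = card J"
    using le card by (simp add: index_le_def)
  have "(MIN S \<in> ?\<S> I. ?F I S) \<in> ?F I ` ?\<S> I"
    by (rule Min_in) (use finite_index_sets index_le_refl sub in auto)
  then obtain S where S: "S \<subseteq> {..<length \<mu>}" "index_le S I" "ord_minor t A I J = ?F I S"
    using B[OF sub(1,3) card] by auto
  then have "index_le S H"
    using index_le_trans le by blast
  have "ord_minor t A H J \<le> ?F H S"
    unfolding B[OF sub(2,3) cardH] by (rule Min_le) (use finite_index_sets S(1) \<open>index_le S H\<close> in auto)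
  then have "ord_minor t A H J + enat (part_sum \<mu> H) \<le> ?F H S + enat (part_sum \<mu> H)"
    by (rule add_right_mono)
  also have "\<dots> = ?F I S + enat (part_sum \<mu> I)"
    unfolding cancel[OF S(1) sub(2) \<open>index_le S H\<close>] cancel[OF S(1) sub(1) S(2)] ..
  finally show ?thesis
    unfolding S(3) .
qed

definition right_order :: "'a::idom \<Rightarrow> 'a mat \<Rightarrow> nat set \<Rightarrow> enat" where
  "right_order t A I = ord_minor t A I {dim_col A - card I..<dim_col A}"

text \<open>The right-most columns form the greatest index set of their size, and the order falls as
  the columns move right.\<close>

lemma mu_generic_right_order_le:
  assumes gen: "mu_generic t \<mu> A" and sub: "I \<subseteq> {..<length \<mu>}" "J \<subseteq> {..<length \<mu>}"
    and card: "card I = card J"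
  shows "right_order t A I \<le> ord_minor t A I J"
proof -
  have "dim_col A = length \<mu>"
    using mu_generic_carrier[OF gen] by simp
  moreover have "{length \<mu> - card J..<length \<mu>} \<subseteq> {..<length \<mu>}"
    by auto
  ultimately show ?thesis
    unfolding right_order_def
    using mu_generic_minor_column_antimono[OF gen sub _ card index_le_rightmost[OF sub(2)]] card
    by simp
qed

section \<open>Finiteness of the right-most orders\<close>

lemma minor_at_scalar_mat:
  fixes f :: "nat \<Rightarrow> nat"
  assumes "inj_on f {..<k}" "\<And>i. i < k \<Longrightarrow> f i < n"
  shows "minor_at (c \<cdot>\<^sub>m 1\<^sub>m n) k f f = c ^ k"
proof -
  have "mat k k (\<lambda>(i, j). (c \<cdot>\<^sub>m 1\<^sub>m n) $$ (f i, f j)) = c \<cdot>\<^sub>m 1\<^sub>m k"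
    by (rule eq_matI) (use assms in \<open>auto simp: inj_on_eq_iff[OF assms(1)]\<close>)
  then show ?thesis
    unfolding minor_at_def by (simp add: det_smult)
qed

text \<open>Multiplying by the adjugate gives a scalar matrix whose minor on rows and columns f is
  \<open>det A ^ k\<close>. If all minors on the rows f vanished, 0 would divide this nonzero
  power.\<close>

lemma nonzero_minor_exists:
  fixes A :: "'a::idom mat"
  assumes A: "A \<in> carrier_mat n n" "det A \<noteq> 0"
    and f: "inj_on f {..<k}" "\<And>i. i < k \<Longrightarrow> f i < n"
  obtains g where "\<And>j. j < k \<Longrightarrow> g j < n" "minor_at A k f g \<noteq> 0"
proof (rule ccontr)
  assume "\<not> thesis"
  then have zero: "minor_at A k f g = 0" if "\<And>j. j < k \<Longrightarrow> g j < n" for g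
    using that \<open>\<And>g. (\<And>j. j < k \<Longrightarrow> g j < n) \<Longrightarrow> minor_at A k f g \<noteq> 0 \<Longrightarrow> thesis\<close> by blast
  have "0 dvd minor_at (A * adj_mat A) k f f"
    by (rule dvd_minor_at_mult_right[OF A(1) adj_mat(1)[OF A(1)]]) (use f zero in auto)
  moreover have "minor_at (A * adj_mat A) k f f = det A ^ k"
    unfolding adj_mat(2)[OF A(1)] using minor_at_scalar_mat[OF f] .
  ultimately show False
    using A(2) by simp
qed

lemma minor_at_repeated_column:
  assumes A: "A \<in> carrier_mat n m" "\<And>i. i < k \<Longrightarrow> f i < n" "\<And>j. j < k \<Longrightarrow> g j < m"
    and "\<not> inj_on g {..<k}"
  shows "minor_at A k f g = 0"
proof -
  obtain i j where "i < k" "j < k" "i \<noteq> j" "g i = g j"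
    using assms(4) by (auto simp: inj_on_def)
  then show ?thesis
    using minor_at_transpose[OF A] minor_at_repeated_row[of i k j g "transpose_mat A" f] by simp
qed

lemma minor_at_diag_mult:
  assumes A: "A \<in> carrier_mat n m" and "\<And>i. i < k \<Longrightarrow> f i < n" "\<And>j. j < k \<Longrightarrow> g j < m"
  shows "minor_at (mat_diag n d * A) k f g = (\<Prod>i<k. d (f i)) * minor_at A k f g"
proof -
  have "mat k k (\<lambda>(i, j). (mat_diag n d * A) $$ (f i, g j))
      = mat\<^sub>r k k (\<lambda>i. d (f i) \<cdot>\<^sub>v vec k (\<lambda>j. A $$ (f i, g j)))"
    unfolding mat_diag_mult_left[OF A] by (rule eq_matI) (use assms in auto)
  moreover have "mat k k (\<lambda>(i, j). A $$ (f i, g j)) = mat\<^sub>r k k (\<lambda>i. vec k (\<lambda>j. A $$ (f i, g j)))"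
    by (rule eq_matI) auto
  ultimately show ?thesis
    unfolding minor_at_def by (simp add: det_rows_mul atLeast0LessThan)
qed

text \<open>Some minor on the given rows is nonzero, and the right-most one has order at most as
  large.\<close>

lemma mu_generic_right_order_finite:
  assumes t: "uniformizer t" and gen: "mu_generic t \<mu> A" and I: "I \<subseteq> {..<length \<mu>}"
  shows "right_order t A I \<noteq> \<infinity>"
proof -
  let ?r = "length \<mu>" and ?f = "pick I" and ?k = "card I"
  have A: "A \<in> carrier_mat ?r ?r" "det A \<noteq> 0"
    using mu_generic_carrier[OF gen] mu_generic_det_nonzero[OF gen] by simp_all
  have fin: "finite I"
    using I finite_subset by blast
  have f: "bij_betw ?f {..<?k} I"
    using bij_betw_pick[OF fin] .
  then have fr: "?f i < ?r" if "i < ?k" for i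
    using bij_betw_apply[OF f, of i] that I by auto
  obtain g where g: "\<And>j. j < ?k \<Longrightarrow> g j < ?r" "minor_at A ?k ?f g \<noteq> 0"
    using nonzero_minor_exists[OF A bij_betw_imp_inj_on[OF f] fr] by blast
  have inj: "inj_on g {..<?k}"
  proof (rule ccontr)
    assume "\<not> inj_on g {..<?k}"
    then have "minor_at A ?k ?f g = 0"
      by (intro minor_at_repeated_column[OF A(1)] fr g(1))
    with g(2) show False ..
  qed
  let ?J = "g ` {..<?k}"
  have J: "?J \<subseteq> {..<?r}" "card I = card ?J"
    using g(1) inj by (auto simp: card_image)
  have "right_order t A I \<le> ord_minor t A I ?J"
    by (rule mu_generic_right_order_le[OF gen I J])
  also have "ord_minor t A I ?J = ord_at t (minor_at A ?k ?f g)"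
    by (rule ord_minor_eq_ord_minor_at[OF t A(1) f I _ J(1)]) (use inj in \<open>simp add: bij_betw_def\<close>)
  also have "\<dots> < \<infinity>"
    using ord_at_finite[OF g(2)] by simp
  finally show ?thesis
    by simp
qed

section \<open>The Pluecker inequality for right-most orders\<close>

lemma bij_betw_fun_upd_Suc:
  assumes "bij_betw h {..<n::nat} K" "a \<notin> K"
  shows "bij_betw (h(n := a)) {..<Suc n} (insert a K)"
proof -
  have "bij_betw (h(n := a)) {..<n} K"
    using assms(1) by (subst bij_betw_cong[of _ _ h]) auto
  then have "bij_betw (h(n := a)) ({..<n} \<union> {n}) (K \<union> {a})"
    by (rule bij_betw_combine) (use assms(2) in \<open>auto simp: bij_betw_def\<close>)
  then show ?thesis
    by (simp add: lessThan_Suc)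
qed

lemma right_order_pluecker:
  fixes A :: "'a::discrete_valuation_ring mat"
  assumes t: "uniformizer t" and A: "A \<in> carrier_mat r r"
    and K: "K \<subseteq> {..<r}" and xyz: "{x, y, z} \<subseteq> {..<r} - K" "x \<noteq> y" "x \<noteq> z" "y \<noteq> z"
  shows "min (right_order t A (insert y K) + right_order t A (insert x (insert z K)))
      (right_order t A (insert z K) + right_order t A (insert x (insert y K)))
    \<le> right_order t A (insert x K) + right_order t A (insert y (insert z K))"
proof -
  have fin: "finite K"
    using K finite_subset by blast
  define q where "q = card K"
  define h where "h = pick K"
  \<comment> \<open>Listing the columns from the right lets a single g serve both minor sizes: its
    first k values are the k right-most columns for every k.\<close>
  define g where "g j = r - 1 - j" for j
  have h: "bij_betw h {..<q} K"
    unfolding h_def q_def using bij_betw_pick[OF fin] .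
  have g: "bij_betw g {..<k} {r - k..<r}" if "k \<le> r" for k
    by (rule bij_betw_byWitness[of _ g]) (use that in \<open>auto simp: g_def\<close>)
  have ord: "right_order t A I = ord_at t (minor_at A k f g)"
    if "bij_betw f {..<k} I" "I \<subseteq> {..<r}" "card I = k" for I f k
  proof -
    have "k \<le> r"
      using card_mono[OF _ that(2)] that(3) by simp
    moreover have "{r - k..<r} \<subseteq> {..<r}"
      by auto
    ultimately show ?thesis
      unfolding right_order_def using ord_minor_eq_ord_minor_at[OF t A that(1,2) g] A that(3) by simp
  qed
  have one: "right_order t A (insert a K) = ord_at t (minor_at A (Suc q) (h(q := a)) g)"
    if "a < r" "a \<notin> K" for a
  proof (rule ord)
    show "bij_betw (h(q := a)) {..<Suc q} (insert a K)"
      by (rule bij_betw_fun_upd_Suc[OF h that(2)])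
  qed (use K that fin in \<open>auto simp: q_def\<close>)
  have two: "right_order t A (insert a (insert b K))
      = ord_at t (minor_at A (q + 2) (h(q := a, Suc q := b)) g)"
    if "a < r" "a \<notin> K" "b < r" "b \<notin> K" "a \<noteq> b" for a b
  proof (rule ord)
    show "bij_betw (h(q := a, Suc q := b)) {..<q + 2} (insert a (insert b K))"
      using bij_betw_fun_upd_Suc[OF bij_betw_fun_upd_Suc[OF h that(2)], of b] that(4,5)
      by (simp add: insert_commute)
  qed (use K that fin in \<open>auto simp: q_def\<close>)
  define M where "M a = minor_at A (Suc q) (h(q := a)) g" for a
  define M2 where "M2 a b = minor_at A (q + 2) (h(q := a, Suc q := b)) g" for a b
  have "M x * M2 y z = M y * M2 x z + (- M z) * M2 x y"
    using three_term_pluecker[of A q h x g y z] unfolding M_def M2_def by (simp add: algebra_simps)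
  then have "min (ord_at t (M y * M2 x z)) (ord_at t ((- M z) * M2 x y)) \<le> ord_at t (M x * M2 y z)"
    using ord_at_add_ge[OF t] by metis
  moreover have "ord_at t (- M z) = ord_at t (M z)"
    by (rule antisym; rule ord_at_mono_dvd[OF t]) simp_all
  ultimately have "min (ord_at t (M y) + ord_at t (M2 x z)) (ord_at t (M z) + ord_at t (M2 x y))
      \<le> ord_at t (M x) + ord_at t (M2 y z)"
    by (simp only: ord_at_mult[OF t])
  then show ?thesis
    using xyz by (simp add: one two M_def M2_def)
qed

lemma mu_generic_generic_orders:
  fixes t :: "'a::discrete_valuation_ring"
  assumes t: "uniformizer t" and \<mu>: "sorted_wrt (\<ge>) \<mu>" and gen: "mu_generic t \<mu> A"
  shows "generic_orders (length \<mu>) \<mu> (\<lambda>I. the_enat (right_order t A I))"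
proof
  let ?r = "length \<mu>"
  have A: "A \<in> carrier_mat ?r ?r"
    using mu_generic_carrier[OF gen] .
  have fin: "enat (the_enat (right_order t A I)) = right_order t A I" if "I \<subseteq> {..<?r}" for I
    using mu_generic_right_order_finite[OF t gen that] by auto
  fix I H assume I: "I \<subseteq> {..<?r}" and H: "H \<subseteq> {..<?r}" and le: "index_le I H"
  let ?J = "{?r - card I..<?r}"
  have card: "card I = card H"
    using le by (simp add: index_le_def)
  have "card I \<le> ?r"
    using card_mono[OF _ I] by simp
  then have J: "?J \<subseteq> {..<?r}" "card I = card ?J"
    by auto
  have "right_order t A I \<le> right_order t A H"
    using mu_generic_minor_mono[OF gen I H J le] A card by (simp add: right_order_def)
  then show "the_enat (right_order t A I) \<le> the_enat (right_order t A H)"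
    using fin[OF I] fin[OF H] by (metis enat_ord_simps(1))
  have "right_order t A H + enat (part_sum \<mu> H) \<le> right_order t A I + enat (part_sum \<mu> I)"
    using mu_generic_weighted_minor_antimono[OF gen \<mu> I H J le] A card by (simp add: right_order_def)
  then show "the_enat (right_order t A H) + part_sum \<mu> H \<le> the_enat (right_order t A I) + part_sum \<mu> I"
    using fin[OF I] fin[OF H] by (metis enat_ord_simps(1) plus_enat_simps(1))
next
  let ?r = "length \<mu>"
  have A: "A \<in> carrier_mat ?r ?r"
    using mu_generic_carrier[OF gen] .
  fix K x y z
  assume K: "K \<subseteq> {..<?r}" and xyz: "{x, y, z} \<subseteq> {..<?r} - K" "x \<noteq> y" "x \<noteq> z" "y \<noteq> z"
  define w where "w I = the_enat (right_order t A I)" for I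
  have w: "right_order t A I = enat (w I)" if "I \<subseteq> {..<?r}" for I
    using mu_generic_right_order_finite[OF t gen that] by (auto simp: w_def)
  have "min (enat (w (insert y K)) + enat (w (insert x (insert z K))))
      (enat (w (insert z K)) + enat (w (insert x (insert y K))))
    \<le> enat (w (insert x K)) + enat (w (insert y (insert z K)))"
    using right_order_pluecker[OF t A K xyz] K xyz(1) by (simp add: w)
  then show "min (the_enat (right_order t A (insert y K)) + the_enat (right_order t A (insert x (insert z K))))
      (the_enat (right_order t A (insert z K)) + the_enat (right_order t A (insert x (insert y K))))
    \<le> the_enat (right_order t A (insert x K)) + the_enat (right_order t A (insert y (insert z K)))"
    unfolding w_def[symmetric] by (simp add: min_def split: if_splits)
qed (use \<mu> in auto)

section \<open>Minors of the truncated product under pair equivalence\<close>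

text \<open>\<open>W D\<^sub>\<mu> = D\<^sub>\<mu> Q\<close> forces \<open>t ^ (\<mu>\<^sub>j - \<mu>\<^sub>i)\<close> to divide \<open>Q\<^sub>i\<^sub>j\<close>, and truncating the parts at
  \<open>c\<close> only shrinks these differences.\<close>

lemma truncated_conjugate:
  fixes t :: "'a::idom"
  assumes "t \<noteq> 0" and W: "W \<in> carrier_mat r r" and Q: "Q \<in> carrier_mat r r" and \<mu>: "length \<mu> = r"
    and WQ: "W * D_mat t \<mu> = D_mat t \<mu> * Q"
  obtains V where "V \<in> carrier_mat r r"
    "V * mat_diag r (\<lambda>i. t ^ min (\<mu> ! i) c) = mat_diag r (\<lambda>i. t ^ min (\<mu> ! i) c) * Q"
proof -
  let ?m = "\<lambda>i. min (\<mu> ! i) c"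
  have entry: "W $$ (i, j) * t ^ (\<mu> ! j) = t ^ (\<mu> ! i) * Q $$ (i, j)" if "i < r" "j < r" for i j
  proof -
    have "(W * D_mat t \<mu>) $$ (i, j) = (D_mat t \<mu> * Q) $$ (i, j)"
      by (simp only: WQ)
    then show ?thesis
      unfolding D_mat_def \<mu> mat_diag_mult_left[OF Q] mat_diag_mult_right[OF W] using that by simp
  qed
  have "\<exists>v. v * t ^ ?m j = t ^ ?m i * Q $$ (i, j)" if "i < r" "j < r" for i j
  proof (cases "\<mu> ! j \<le> \<mu> ! i")
    case True
    then have "t ^ ?m j dvd t ^ ?m i * Q $$ (i, j)"
      by (intro dvd_mult2 le_imp_power_dvd) simp
    then show ?thesis
      by (metis dvdE mult.commute)
  next
    case False
    then have "t ^ (\<mu> ! j) = t ^ (\<mu> ! i) * t ^ (\<mu> ! j - \<mu> ! i)"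
      by (simp flip: power_add)
    with entry[OF that] have "t ^ (\<mu> ! i) * (t ^ (\<mu> ! j - \<mu> ! i) * W $$ (i, j)) = t ^ (\<mu> ! i) * Q $$ (i, j)"
      by (simp add: algebra_simps)
    then have Qij: "Q $$ (i, j) = t ^ (\<mu> ! j - \<mu> ! i) * W $$ (i, j)"
      using \<open>t \<noteq> 0\<close> by simp
    have "t ^ ?m j dvd t ^ (?m i + (\<mu> ! j - \<mu> ! i))"
      by (rule le_imp_power_dvd) (use False in auto)
    then have "t ^ ?m j dvd t ^ ?m i * Q $$ (i, j)"
      unfolding Qij power_add mult.assoc[symmetric] by simp
    then show ?thesis
      by (metis dvdE mult.commute)
  qed
  then obtain v where v: "\<And>i j. i < r \<Longrightarrow> j < r \<Longrightarrow> v i j * t ^ ?m j = t ^ ?m i * Q $$ (i, j)"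
    by metis
  show thesis
  proof
    show V: "mat r r (\<lambda>(i, j). v i j) \<in> carrier_mat r r"
      by simp
    show "mat r r (\<lambda>(i, j). v i j) * mat_diag r (\<lambda>i. t ^ ?m i) = mat_diag r (\<lambda>i. t ^ ?m i) * Q"
      unfolding mat_diag_mult_left[OF Q] mat_diag_mult_right[OF V]
      by (rule eq_matI) (use v in auto)
  qed
qed

text \<open>The bound need only hold over row sets, for right-most columns; genericity extends it to
  any columns, and lists with repetitions give zero minors.\<close>

lemma generic_power_dvd_truncated_minor:
  fixes t :: "'a::discrete_valuation_ring"
  assumes t: "uniformizer t" and gen: "mu_generic t \<mu> A" and r: "length \<mu> = r"
    and le: "\<And>H. H \<subseteq> {..<r} \<Longrightarrow> card H = k \<Longrightarrow>
      e \<le> the_enat (right_order t A H) + (\<Sum>h\<in>H. min (\<mu> ! h) c)"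
    and f: "\<And>i. i < k \<Longrightarrow> f i < r" and g: "\<And>j. j < k \<Longrightarrow> g j < r"
  shows "t ^ e dvd minor_at (mat_diag r (\<lambda>i. t ^ min (\<mu> ! i) c) * A) k f g"
proof -
  have A: "A \<in> carrier_mat r r"
    using mu_generic_carrier[OF gen] r by simp
  consider "\<not> inj_on f {..<k}" | "\<not> inj_on g {..<k}" | "inj_on f {..<k}" "inj_on g {..<k}"
    by blast
  then show ?thesis
  proof cases
    case 1
    then obtain i j where "i < k" "j < k" "i \<noteq> j" "f i = f j"
      by (auto simp: inj_on_def)
    then show ?thesis
      using minor_at_repeated_row by (metis dvd_0_right)
  next
    case 2
    then have "minor_at A k f g = 0"
      by (intro minor_at_repeated_column[OF A] f g)
    then show ?thesis
      by (simp add: minor_at_diag_mult[OF A] f g)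
  next
    case 3
    let ?H = "f ` {..<k}" and ?J = "g ` {..<k}"
    have bij: "bij_betw f {..<k} ?H" "bij_betw g {..<k} ?J"
      using 3 by (auto simp: bij_betw_def)
    have sub: "?H \<subseteq> {..<r}" "?J \<subseteq> {..<r}"
      using f g by auto
    have card: "card ?H = k" "card ?J = k"
      using 3 by (simp_all add: card_image)
    have "right_order t A ?H \<le> ord_minor t A ?H ?J"
      using mu_generic_right_order_le[OF gen] sub card r by simp
    also have "\<dots> = ord_at t (minor_at A k f g)"
      by (rule ord_minor_eq_ord_minor_at[OF t A bij(1) sub(1) bij(2) sub(2)])
    finally have "enat (the_enat (right_order t A ?H)) \<le> ord_at t (minor_at A k f g)"
      using mu_generic_right_order_finite[OF t gen, of ?H] sub(1) r by auto
    then have "t ^ the_enat (right_order t A ?H) dvd minor_at A k f g"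
      by (simp add: le_ord_at_iff[OF t])
    moreover have "(\<Prod>i<k. t ^ min (\<mu> ! f i) c) = t ^ (\<Sum>h\<in>?H. min (\<mu> ! h) c)"
      using 3(1) by (simp add: sum.reindex flip: power_sum)
    ultimately have "t ^ ((\<Sum>h\<in>?H. min (\<mu> ! h) c) + the_enat (right_order t A ?H))
        dvd minor_at (mat_diag r (\<lambda>i. t ^ min (\<mu> ! i) c) * A) k f g"
      by (simp add: minor_at_diag_mult[OF A] f g power_add mult_dvd_mono)
    moreover have "t ^ e dvd t ^ ((\<Sum>h\<in>?H. min (\<mu> ! h) c) + the_enat (right_order t A ?H))"
      by (rule le_imp_power_dvd) (use le[OF sub(1) card(1)] in simp)
    ultimately show ?thesis
      using dvd_trans by blast
  qed
qed

text \<open>Let D_c be the truncated diagonal matrix. Since D_c A' = V (D_c A) T with integral V and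
  T, a power of \<open>t\<close> dividing all minors of size r - m of D_c A divides those of D_c A'.
  Testing the edge rows with the right-most columns bounds \<open>A.tail_order m p + c * p\<close>
  by the same expression for \<open>A'\<close>, and the common terms cancel.\<close>

lemma right_order_edge_rows_le:
  fixes t :: "'a::discrete_valuation_ring"
  assumes t: "uniformizer t" and \<mu>: "sorted_wrt (\<ge>) \<mu>" "length \<mu> = r"
    and gen: "mu_generic t \<mu> A" "mu_generic t \<mu> A'"
    and equiv: "pair_equiv r (D_mat t \<mu>, A) (D_mat t \<mu>, A')"
    and mp: "m + p \<le> r"
  shows "the_enat (right_order t A (edge_rows r m p)) \<le> the_enat (right_order t A' (edge_rows r m p))"
proof -
  interpret A: generic_orders r \<mu> "\<lambda>I. the_enat (right_order t A I)"
    using mu_generic_generic_orders[OF t \<mu>(1) gen(1)] \<mu>(2) by simp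
  interpret A': generic_orders r \<mu> "\<lambda>I. the_enat (right_order t A' I)"
    using mu_generic_generic_orders[OF t \<mu>(1) gen(2)] \<mu>(2) by simp
  have A: "A \<in> carrier_mat r r" and A': "A' \<in> carrier_mat r r"
    using mu_generic_carrier[OF gen(1)] mu_generic_carrier[OF gen(2)] \<mu>(2) by simp_all
  \<comment> \<open>With c supporting \<open>A.tail_order m\<close> at p, the exponent
    \<open>?e\<close> is the least of the values at all q, hence a lower bound over all row
    sets.\<close>
  obtain c where c: "\<And>q. m + q \<le> r \<Longrightarrow> A.tail_order m p + c * p \<le> A.tail_order m q + c * q"
    using A.tail_order_supporting_line[OF mp] by blast
  let ?e = "A.tail_order m p + c * p" and ?k = "r - m"
  have e_le: "?e \<le> the_enat (right_order t A H) + (\<Sum>h\<in>H. min (\<mu> ! h) c)"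
    if H: "H \<subseteq> {..<r}" "card H = ?k" for H
  proof -
    obtain q where "m + q \<le> r"
      "A.tail_order m q + c * q \<le> the_enat (right_order t A H) + (\<Sum>h\<in>H. min (\<mu> ! h) c)"
      using A.tail_order_le_truncated[OF H] mp by (metis add_leD1)
    then show ?thesis
      using c[of q] by linarith
  qed
  obtain W Q T where W: "W \<in> carrier_mat r r" and Q: "Q \<in> carrier_mat r r" and T: "T \<in> carrier_mat r r"
    and WQ: "W * D_mat t \<mu> = D_mat t \<mu> * Q" and QAT: "A' = Q * A * T"
    using pair_equiv_D_matE[OF equiv \<mu>(2) A] .
  let ?D = "mat_diag r (\<lambda>i. t ^ min (\<mu> ! i) c)"
  obtain V where V: "V \<in> carrier_mat r r" and VD: "V * ?D = ?D * Q"
    using truncated_conjugate[OF uniformizer_nonzero[OF t] W Q \<mu>(2) WQ] .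
  have "?D * A' = ?D * Q * A * T"
    unfolding QAT using Q A T by (simp add: assoc_mult_mat[of _ r r _ r _ r])
  also have "\<dots> = V * (?D * A) * T"
    unfolding VD[symmetric] using V A T by (simp add: assoc_mult_mat[of _ r r _ r _ r])
  finally have DA': "?D * A' = V * (?D * A) * T" .
  let ?E = "edge_rows r m p"
  let ?f = "pick ?E" and ?g = "pick {m..<r}"
  have E: "?E \<subseteq> {..<r}" "card ?E = ?k" "finite ?E"
    using edge_rows_subset[OF mp] card_edge_rows[OF mp] by (auto simp: edge_rows_def)
  have f: "bij_betw ?f {..<?k} ?E" and g: "bij_betw ?g {..<?k} {m..<r}"
    using bij_betw_pick[OF E(3)] E(2) bij_betw_pick[of "{m..<r}"] by simp_all
  have fr: "?f i < r" and gr: "?g i < r" if "i < ?k" for i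
    using bij_betw_apply[OF f, of i] bij_betw_apply[OF g, of i] E(1) that by auto
  have "t ^ ?e dvd minor_at (V * (?D * A) * T) ?k ?f ?g"
  proof (rule dvd_minor_at_mult_right[of _ r r])
    fix h assume h: "\<And>j. j < ?k \<Longrightarrow> h j < r"
    show "t ^ ?e dvd minor_at (V * (?D * A)) ?k ?f h"
    proof (rule dvd_minor_at_mult_left[OF V])
      fix f' assume f': "\<And>i. i < ?k \<Longrightarrow> f' i < r"
      show "t ^ ?e dvd minor_at (?D * A) ?k f' h"
        by (rule generic_power_dvd_truncated_minor[OF t gen(1) \<mu>(2) e_le f' h])
    qed (use fr h mult_carrier_mat[OF mat_diag_dim A] in auto)
  qed (use T fr gr mult_carrier_mat[OF V mult_carrier_mat[OF mat_diag_dim A]] in auto)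
  also have "minor_at (V * (?D * A) * T) ?k ?f ?g
      = t ^ (\<Sum>h\<in>?E. min (\<mu> ! h) c) * minor_at A' ?k ?f ?g"
  proof -
    have "(\<Prod>i<?k. t ^ min (\<mu> ! ?f i) c) = t ^ (\<Sum>h\<in>?E. min (\<mu> ! h) c)"
      using sum.reindex_bij_betw[OF f, of "\<lambda>h. min (\<mu> ! h) c"] by (simp flip: power_sum)
    then show ?thesis
      unfolding DA'[symmetric] by (simp add: minor_at_diag_mult[OF A'] fr gr)
  qed
  finally have "enat ?e \<le> ord_at t (t ^ (\<Sum>h\<in>?E. min (\<mu> ! h) c) * minor_at A' ?k ?f ?g)"
    by (simp add: le_ord_at_iff[OF t])
  also have "\<dots> = enat (\<Sum>h\<in>?E. min (\<mu> ! h) c) + ord_at t (minor_at A' ?k ?f ?g)"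
    using ord_at_unit_times_power[OF t, of 1] by (simp add: ord_at_mult[OF t])
  also have "ord_at t (minor_at A' ?k ?f ?g) = ord_minor t A' ?E {m..<r}"
    by (rule ord_minor_eq_ord_minor_at[OF t A' f E(1) g, symmetric]) auto
  also have "\<dots> = right_order t A' ?E"
    using A' E(2) mp by (simp add: right_order_def)
  also have "\<dots> = enat (the_enat (right_order t A' ?E))"
    using mu_generic_right_order_finite[OF t gen(2), of ?E] E(1) \<mu>(2) by auto
  finally have "?e \<le> the_enat (right_order t A' ?E) + (\<Sum>h\<in>?E. min (\<mu> ! h) c)"
    by simp
  also have "\<dots> \<le> A'.tail_order m p + c * p"
    by (rule A'.truncated_edge_le[OF mp])
  finally show ?thesis
    by (simp add: A.tail_order_def A'.tail_order_def)
qed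

section \<open>From invariant orders to the filling\<close>

lemma Omega_eq_right_order_edge_rows:
  assumes "A \<in> carrier_mat r r" "m + p \<le> r"
  shows "Omega t r A (int p + 1) (int (m + p)) = int (the_enat (right_order t A (edge_rows r m p)))"
proof -
  have "{i. i < r \<and> int (i + 1) \<notin> {int p + 1..int (m + p)}} = edge_rows r m p"
    using assms(2) by (auto simp: edge_rows_def)
  then show ?thesis
    using assms(1) by (simp only: Omega_def Let_def right_order_def carrier_matD)
qed

text \<open>Row number 0 does not exist, so the interval from 0 to m removes m rows and not m + 1.
  This case arises in the filling rule for i = j.\<close>

lemma Omega_eq_right_order_initial:
  assumes "A \<in> carrier_mat r r" "m \<le> r"
  shows "Omega t r A 0 (int m) = int (the_enat (right_order t A (edge_rows r m 0)))"
proof -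
  have "{i. i < r \<and> int (i + 1) \<notin> {0..int m}} = edge_rows r m 0"
    using assms(2) by (auto simp: edge_rows_def)
  then show ?thesis
    using assms(1) by (simp only: Omega_def Let_def right_order_def carrier_matD)
qed

theorem mainTheorem2:
  fixes t :: "'a::discrete_valuation_ring"
    and r :: nat
    and M N M' N' Ns Ns' :: "'a mat"
    and \<mu> :: "nat list"
    and k k' :: "nat \<Rightarrow> nat \<Rightarrow> int"
  assumes "residue_field_char_0 TYPE('a)"
    and "uniformizer t"
    and "M \<in> full_rank_mats r" and "N \<in> full_rank_mats r"
    and "M' \<in> full_rank_mats r" and "N' \<in> full_rank_mats r"
    and "pair_equiv r (M, N) (M', N')"
    and "is_inv t r M \<mu>"
    and "mu_generic t \<mu> Ns" and "mu_generic t \<mu> Ns'"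
    and "pair_equiv r (D_mat t \<mu>, Ns) (M, N)"
    and "pair_equiv r (D_mat t \<mu>, Ns') (M', N')"
    and "filling_of t r Ns k" and "filling_of t r Ns' k'"
  shows "\<forall>i j. 1 \<le> i \<and> i \<le> j \<and> j \<le> r \<longrightarrow> k i j = k' i j"
proof -
  have \<mu>: "sorted_wrt (\<ge>) \<mu>" "length \<mu> = r"
    using assms(8) by (auto simp: is_inv_def)
  have Ns: "Ns \<in> carrier_mat r r" and Ns': "Ns' \<in> carrier_mat r r"
    using mu_generic_carrier[OF assms(9)] mu_generic_carrier[OF assms(10)] \<mu>(2) by simp_all
  have D: "D_mat t \<mu> \<in> carrier_mat r r"
    using D_mat_carrier[of t \<mu>] \<mu>(2) by simp
  have carrier: "M' \<in> carrier_mat r r" "N' \<in> carrier_mat r r"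
    using assms(5,6) by (auto simp: full_rank_mats_def)
  have equiv: "pair_equiv r (D_mat t \<mu>, Ns) (D_mat t \<mu>, Ns')"
    using pair_equiv_trans[OF pair_equiv_trans[OF assms(11,7) D Ns]
      pair_equiv_sym[OF assms(12) D Ns'] D Ns] .
  have eq: "the_enat (right_order t Ns (edge_rows r m p)) = the_enat (right_order t Ns' (edge_rows r m p))"
    if "m + p \<le> r" for m p
    using right_order_edge_rows_le[OF assms(2) \<mu> assms(9,10) equiv that]
      right_order_edge_rows_le[OF assms(2) \<mu> assms(10,9) pair_equiv_sym[OF equiv D Ns] that]
    by simp
  have Omega_eq: "Omega t r Ns (int a) (int b) = Omega t r Ns' (int a) (int b)"
    if "a \<le> b + 1" "b \<le> r" for a b
  proof (cases a)
    case 0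
    then show ?thesis
      using Omega_eq_right_order_initial[OF Ns that(2)] Omega_eq_right_order_initial[OF Ns' that(2)]
        eq[of b 0] that(2) by simp
  next
    case (Suc p)
    define m where "m = b - p"
    have b: "b = m + p" and mp: "m + p \<le> r"
      using that Suc by (simp_all add: m_def)
    show ?thesis
      using Omega_eq_right_order_edge_rows[OF Ns mp] Omega_eq_right_order_edge_rows[OF Ns' mp] eq[OF mp]
      unfolding b Suc by (simp add: add.commute)
  qed
  \<comment> \<open>Includes the empty sum i = 0, because each entry is recovered as the difference
    of two consecutive partial sums.\<close>
  have sums: "(\<Sum>s = 1..i. k s j) = (\<Sum>s = 1..i. k' s j)" if "i \<le> j" "j \<le> r" for i j
  proof (cases "i = 0")
    case False
    then have i: "1 \<le> i"
      by simp
    have idx: "int j - int i = int (j - i)" "int j - 1 = int (j - 1)" "int j - int i + 1 = int (j - i + 1)"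
      using i that by simp_all
    have "Omega t r Ns (int (j - i)) (int (j - 1)) = Omega t r Ns' (int (j - i)) (int (j - 1))"
      by (rule Omega_eq) (use i that in auto)
    moreover have "Omega t r Ns (int (j - i + 1)) (int j) = Omega t r Ns' (int (j - i + 1)) (int j)"
      by (rule Omega_eq) (use i that in auto)
    ultimately have "Omega t r Ns (int j - int i) (int j - 1) - Omega t r Ns (int j - int i + 1) (int j)
        = Omega t r Ns' (int j - int i) (int j - 1) - Omega t r Ns' (int j - int i + 1) (int j)"
      unfolding idx(3) unfolding idx(1,2) by simp
    moreover have "(\<Sum>s = 1..i. k s j)
        = Omega t r Ns (int j - int i) (int j - 1) - Omega t r Ns (int j - int i + 1) (int j)"
      using assms(13) i that unfolding filling_of_def by blast
    moreover have "(\<Sum>s = 1..i. k' s j)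
        = Omega t r Ns' (int j - int i) (int j - 1) - Omega t r Ns' (int j - int i + 1) (int j)"
      using assms(14) i that unfolding filling_of_def by blast
    ultimately show ?thesis
      by simp
  qed simp
  show ?thesis
  proof (intro allI impI)
    fix i j assume ij: "1 \<le> i \<and> i \<le> j \<and> j \<le> r"
    then obtain i' where i': "i = Suc i'"
      by (cases i) auto
    show "k i j = k' i j"
      using sums[of i j] sums[of i' j] ij unfolding i' by simp
  qed
qed

end
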